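(* Let $X,Y$ be complex Banach spaces of dimension at least two such that $X$ is uniformly convex, and let $m\in\mathbb N$, $m\ge 2$. The following are equivalent: (i) the pair $(c_0(X),Y)$ has the BPBp-RSE; (ii) the pair $(\ell_\infty^m(X),Y)$ has the BPBp-RSE; (iii) $Y$ is $\mathbb C$-uniformly convex.
   Context: All Banach spaces here are complex; $B_X$, $S_X$ are the closed unit ball and unit sphere of $X$; $\mathbb T=\{\lambda\in\mathbb C:|\lambda|=1\}$; $\mathcal L(X,Y)$ is the space of bounded linear operators. $c_0(X)$ is the space of sequences in $X$ converging to $0$ in norm, with the supremum norm; $\ell_\infty^m(X)$ is $X^m$ with the maximum norm. An operator $T\in\mathcal L(Z,Y)$ is range strongly exposing, $T\in\mathrm{RSE}(Z,Y)$, if there is $x_0\in S_Z$ such that whenever $(x_n)\subseteq B_Z$ satisfies $\|Tx_n\|\to\|T\|$, there are a subsequence $(x_{\sigma(n)})$ and $\lambda\in\mathbb T$ with $Tx_{\sigma(n)}\to\lambda Tx_0$. The pair $(Z,Y)$ has the BPBp-RSE if for every $\varepsilon>0$ there is $0<\eta(\varepsilon)<\varepsilon$ such that for every $T\in\mathcal L(Z,Y)$ with $\|T\|=1$ and every $x\in S_Z$ with $\|Tx\|>1-\eta(\varepsilon)$, there exist $S\in\mathrm{RSE}(Z,Y)$ and $x_0\in S_Z$ with $\|S\|=\|Sx_0\|=1$, $\|S-T\|<\varepsilon$ and $\|x-x_0\|<\varepsilon$. $X$ is uniformly convex if for every $\varepsilon>0$ there is $0<\delta<1$ such that $x_1,x_2\in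 S_X$ and $\|x_1+x_2\|/2>1-\delta$ imply $\|x_1-x_2\|<\varepsilon$. A complex Banach space $Y$ is $\mathbb C$-uniformly convex if for every $\varepsilon>0$ there is $\delta>0$ such that whenever $y_0,y_1\in Y$ satisfy $\|y_0+wy_1\|\le 1$ for every $w\in\mathbb T$ and $\|y_1\|>\varepsilon$, one has $\|y_0\|<1-\delta$. *)

theory Defs
  imports "HOL-Analysis.Analysis"
begin

class complex_normed_vector = real_normed_vector +
  fixes scaleC :: "complex \<Rightarrow> 'a \<Rightarrow> 'a" (infixr "*\<^sub>C" 75)
  assumes scaleC_add_right: "a *\<^sub>C (x + y) = a *\<^sub>C x + a *\<^sub>C y"
    and scaleC_add_left: "(a + b) *\<^sub>C x = a *\<^sub>C x + b *\<^sub>C x"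
    and scaleC_scaleC: "a *\<^sub>C (b *\<^sub>C x) = (a * b) *\<^sub>C x"
    and scaleR_scaleC: "r *\<^sub>R x = complex_of_real r *\<^sub>C x"
    and norm_scaleC: "norm (a *\<^sub>C x) = cmod a * norm x"

class complex_banach = complex_normed_vector + complete_space

subclass (in complex_banach) banach ..

global_interpretation complex_vector:
  vector_space "scaleC :: complex \<Rightarrow> 'a \<Rightarrow> 'a::complex_normed_vector"
proof
  show "1 *\<^sub>C x = x" for x :: 'a
    using scaleR_scaleC[of 1 x] by simp
qed (simp_all add: scaleC_add_right scaleC_add_left scaleC_scaleC)

text \<open>\<^term>\<open>complex_vector.dim\<close> is \<open>0\<close> on infinite-dimensional spaces, so the
  condition on the dimension is expressed by the existence of an independent pair.\<close>

definition dim_at_least_two :: "'a::complex_normed_vector itself \<Rightarrow> bool" where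
  "dim_at_least_two _ \<longleftrightarrow>
     (\<exists>B :: 'a set. complex_vector.independent B \<and> card B = 2)"

lemma tendsto_scaleC_zero:
  fixes f :: "nat \<Rightarrow> 'a::complex_normed_vector"
  assumes "f \<longlonglongrightarrow> 0"
  shows "(\<lambda>i. c *\<^sub>C f i) \<longlonglongrightarrow> 0"
proof -
  have "(\<lambda>i. cmod c * norm (f i)) \<longlonglongrightarrow> cmod c * 0"
    using assms by (intro tendsto_mult tendsto_const) (simp add: tendsto_norm_zero)
  then show ?thesis
    by (simp add: tendsto_norm_zero_iff[of "\<lambda>i. c *\<^sub>C f i", symmetric] norm_scaleC)
qed

typedef (overloaded) 'a c0 = "{f :: nat \<Rightarrow> 'a::complex_normed_vector. f \<longlonglongrightarrow> 0}"
  morphisms c0_nth Abs_c0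
  by (rule exI[of _ "\<lambda>_. 0"]) simp

setup_lifting type_definition_c0

lemma c0_nth_tendsto: "c0_nth f \<longlonglongrightarrow> 0"
  using c0_nth[of f] by simp

lemma c0_eqI: "(\<And>i. c0_nth f i = c0_nth g i) \<Longrightarrow> f = g"
  by transfer auto

instantiation c0 :: (complex_normed_vector) complex_normed_vector
begin

lift_definition zero_c0 :: "'a c0" is "\<lambda>_. 0" by simp

lift_definition plus_c0 :: "'a c0 \<Rightarrow> 'a c0 \<Rightarrow> 'a c0" is "\<lambda>f g i. f i + g i"
  by (simp add: tendsto_add_zero)

lift_definition minus_c0 :: "'a c0 \<Rightarrow> 'a c0 \<Rightarrow> 'a c0" is "\<lambda>f g i. f i - g i"
  using tendsto_diff by fastforce

lift_definition uminus_c0 :: "'a c0 \<Rightarrow> 'a c0" is "\<lambda>f i. - f i"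
  using tendsto_minus by fastforce

lift_definition scaleR_c0 :: "real \<Rightarrow> 'a c0 \<Rightarrow> 'a c0" is "\<lambda>r f i. r *\<^sub>R f i"
  using tendsto_scaleR[OF tendsto_const] by fastforce

lift_definition scaleC_c0 :: "complex \<Rightarrow> 'a c0 \<Rightarrow> 'a c0" is "\<lambda>c f i. c *\<^sub>C f i"
  by (simp add: tendsto_scaleC_zero)

definition norm_c0 :: "'a c0 \<Rightarrow> real" where
  "norm_c0 f = (SUP i. norm (c0_nth f i))"

definition sgn_c0 :: "'a c0 \<Rightarrow> 'a c0" where
  "sgn_c0 f = inverse (norm f) *\<^sub>R f"

definition dist_c0 :: "'a c0 \<Rightarrow> 'a c0 \<Rightarrow> real" where
  "dist_c0 f g = norm (f - g)"

definition uniformity_c0 :: "('a c0 \<times> 'a c0) filter" where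
  "uniformity_c0 = (INF e\<in>{0<..}. principal {(f, g). dist f g < e})"

definition open_c0 :: "'a c0 set \<Rightarrow> bool" where
  "open_c0 U = (\<forall>f\<in>U. \<forall>\<^sub>F (f', g) in uniformity. f' = f \<longrightarrow> g \<in> U)"

lemmas c0_nth_simps =
  zero_c0.rep_eq plus_c0.rep_eq minus_c0.rep_eq uminus_c0.rep_eq scaleR_c0.rep_eq scaleC_c0.rep_eq

lemma norm_c0_nth_le: "norm (c0_nth f i) \<le> norm f"
proof -
  have "Bseq (c0_nth f)"
    using c0_nth_tendsto convergentI convergent_imp_Bseq by blast
  then have "bdd_above (range (\<lambda>i. norm (c0_nth f i)))"
    by (auto simp: Bseq_def bdd_above_def)
  then show ?thesis
    unfolding norm_c0_def by (rule cSUP_upper2) auto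
qed

lemma norm_c0_le: "(\<And>i. norm (c0_nth f i) \<le> b) \<Longrightarrow> norm f \<le> b"
  unfolding norm_c0_def by (rule cSUP_least) auto

instance
proof
  fix a b :: real and c d :: complex and f g h :: "'a c0" and U :: "'a c0 set"
  show "f + g + h = f + (g + h)" "f + g = g + f" "0 + f = f" "- f + f = 0" "f - g = f + - g"
    "a *\<^sub>R (f + g) = a *\<^sub>R f + a *\<^sub>R g" "(a + b) *\<^sub>R f = a *\<^sub>R f + b *\<^sub>R f"
    "a *\<^sub>R b *\<^sub>R f = (a * b) *\<^sub>R f" "1 *\<^sub>R f = f"
    "c *\<^sub>C (f + g) = c *\<^sub>C f + c *\<^sub>C g" "(c + d) *\<^sub>C f = c *\<^sub>C f + d *\<^sub>C f"
    "c *\<^sub>C d *\<^sub>C f = (c * d) *\<^sub>C f" "a *\<^sub>R f = complex_of_real a *\<^sub>C f"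
    by (rule c0_eqI; simp add: c0_nth_simps scaleR_add_left scaleR_add_right
        scaleC_add_left scaleC_add_right scaleC_scaleC scaleR_scaleC[symmetric] add.assoc add.commute)+
  show "dist f g = norm (f - g)" "sgn f = inverse (norm f) *\<^sub>R f"
    "uniformity = (INF e\<in>{0<..}. principal {(f::'a c0, g). dist f g < e})"
    "open U = (\<forall>f\<in>U. \<forall>\<^sub>F (f', g) in uniformity. f' = f \<longrightarrow> g \<in> U)"
    by (fact dist_c0_def sgn_c0_def uniformity_c0_def open_c0_def)+
  show "(norm f = 0) = (f = 0)"
  proof
    assume "norm f = 0"
    with norm_c0_nth_le[of f] show "f = 0"
      by (intro c0_eqI) (simp add: c0_nth_simps)
  qed (simp add: norm_c0_def c0_nth_simps)
  show "norm (f + g) \<le> norm f + norm g"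
    by (intro norm_c0_le)
      (auto simp: c0_nth_simps intro!: order_trans[OF norm_triangle_ineq] add_mono norm_c0_nth_le)
  have le: "norm (c *\<^sub>C f) \<le> cmod c * norm f" for c and f :: "'a c0"
    by (intro norm_c0_le)
      (auto simp: c0_nth_simps norm_scaleC intro!: mult_left_mono norm_c0_nth_le)
  have sR: "a *\<^sub>R f = complex_of_real a *\<^sub>C f" for a and f :: "'a c0"
    by (rule c0_eqI) (simp add: c0_nth_simps scaleR_scaleC)
  show eq: "norm (c *\<^sub>C f) = cmod c * norm f" for c
  proof (cases "c = 0")
    case True
    then have "c *\<^sub>C f = 0" by (intro c0_eqI) (simp add: c0_nth_simps)
    then show ?thesis using True \<open>(norm f = 0) = (f = 0)\<close> by (simp add: norm_c0_def c0_nth_simps)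
  next
    case False
    then have "inverse c *\<^sub>C c *\<^sub>C f = f"
      by (intro c0_eqI) (simp add: c0_nth_simps)
    with le[of "inverse c" "c *\<^sub>C f"] have "norm f \<le> inverse (cmod c) * norm (c *\<^sub>C f)"
      by (simp add: norm_inverse)
    then have "cmod c * norm f \<le> norm (c *\<^sub>C f)"
      using False by (simp add: field_simps)
    with le[of c f] show ?thesis by simp
  qed
  show "norm (a *\<^sub>R f) = \<bar>a\<bar> * norm f"
    unfolding sR eq by simp
qed

end

instance c0 :: (complex_banach) complex_banach
proof
  fix X :: "nat \<Rightarrow> 'a c0" assume X: "Cauchy X"
  have diff: "norm (c0_nth (X m) i - c0_nth (X n) i) \<le> norm (X m - X n)" for m n i
    using norm_c0_nth_le[of "X m - X n" i] by (simp add: c0_nth_simps)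
  have "convergent (\<lambda>n. c0_nth (X n) i)" for i
    unfolding Cauchy_convergent_iff[symmetric]
    using X diff unfolding Cauchy_iff by (meson le_less_trans)
  then obtain L where L: "\<And>i. (\<lambda>n. c0_nth (X n) i) \<longlonglongrightarrow> L i"
    unfolding convergent_def by metis
  have unif: "\<exists>N. \<forall>n\<ge>N. \<forall>i. norm (c0_nth (X n) i - L i) \<le> e" if "e > 0" for e
  proof -
    from X that obtain N where N: "\<And>m n. m \<ge> N \<Longrightarrow> n \<ge> N \<Longrightarrow> norm (X m - X n) < e"
      unfolding Cauchy_iff by blast
    have "norm (c0_nth (X n) i - L i) \<le> e" if "n \<ge> N" for n i
    proof (rule Lim_bounded)
      show "(\<lambda>m. norm (c0_nth (X n) i - c0_nth (X m) i)) \<longlonglongrightarrow> norm (c0_nth (X n) i - L i)"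
        by (intro tendsto_intros L)
      show "\<forall>m\<ge>N. norm (c0_nth (X n) i - c0_nth (X m) i) \<le> e"
        using N[OF that] diff[of n i] by (meson less_imp_le order_trans)
    qed
    then show ?thesis by blast
  qed
  have "L \<longlonglongrightarrow> 0"
  proof (rule LIMSEQ_I)
    fix e :: real assume "e > 0"
    then obtain n where n: "\<And>i. norm (c0_nth (X n) i - L i) \<le> e / 2"
      using unif[of "e / 2"] by auto
    obtain N where N: "\<And>i. i \<ge> N \<Longrightarrow> norm (c0_nth (X n) i) < e / 2"
      using LIMSEQ_D[OF c0_nth_tendsto, of "e / 2" "X n"] \<open>e > 0\<close> by auto
    have "norm (L i - 0) < e" if "i \<ge> N" for i
    proof -
      have "norm (L i) \<le> norm (c0_nth (X n) i) + norm (c0_nth (X n) i - L i)"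
        by (metis norm_triangle_sub norm_minus_commute)
      with n[of i] N[OF that] show ?thesis by simp
    qed
    then show "\<exists>N. \<forall>i\<ge>N. norm (L i - 0) < e" by blast
  qed
  then have Abs: "c0_nth (Abs_c0 L) = L"
    by (simp add: Abs_c0_inverse)
  have "X \<longlonglongrightarrow> Abs_c0 L"
  proof (rule LIMSEQ_I)
    fix e :: real assume "e > 0"
    then obtain N where N: "\<And>n i. n \<ge> N \<Longrightarrow> norm (c0_nth (X n) i - L i) \<le> e / 2"
      using unif[of "e / 2"] by auto
    have "norm (X n - Abs_c0 L) \<le> e / 2" if "n \<ge> N" for n
      using N[OF that] by (intro norm_c0_le) (simp add: c0_nth_simps Abs)
    with \<open>e > 0\<close> show "\<exists>N. \<forall>n\<ge>N. norm (X n - Abs_c0 L) < e"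
      by (intro exI[of _ N] allI impI) (fastforce intro: le_less_trans)
  qed
  then show "convergent X" by (auto simp: convergent_def)
qed


text \<open>\<open>(X, 'm) linf\<close> is \<open>X\<^sup>m\<close> with the maximum norm, where \<open>m = CARD('m)\<close>.\<close>

typedef (overloaded) ('a, 'm) linf = "UNIV :: ('m::finite \<Rightarrow> 'a::complex_normed_vector) set"
  morphisms linf_nth Abs_linf
  by simp

setup_lifting type_definition_linf

lemma linf_eqI: "(\<And>i. linf_nth f i = linf_nth g i) \<Longrightarrow> f = g"
  by transfer auto

instantiation linf :: (complex_normed_vector, finite) complex_normed_vector
begin

lift_definition zero_linf :: "('a, 'b) linf" is "\<lambda>_. 0" .

lift_definition plus_linf :: "('a, 'b) linf \<Rightarrow> ('a, 'b) linf \<Rightarrow> ('a, 'b) linf"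
  is "\<lambda>f g i. f i + g i" .

lift_definition minus_linf :: "('a, 'b) linf \<Rightarrow> ('a, 'b) linf \<Rightarrow> ('a, 'b) linf"
  is "\<lambda>f g i. f i - g i" .

lift_definition uminus_linf :: "('a, 'b) linf \<Rightarrow> ('a, 'b) linf" is "\<lambda>f i. - f i" .

lift_definition scaleR_linf :: "real \<Rightarrow> ('a, 'b) linf \<Rightarrow> ('a, 'b) linf" is "\<lambda>r f i. r *\<^sub>R f i" .

lift_definition scaleC_linf :: "complex \<Rightarrow> ('a, 'b) linf \<Rightarrow> ('a, 'b) linf"
  is "\<lambda>c f i. c *\<^sub>C f i" .

definition norm_linf :: "('a, 'b) linf \<Rightarrow> real" where
  "norm_linf f = (MAX i. norm (linf_nth f i))"

definition sgn_linf :: "('a, 'b) linf \<Rightarrow> ('a, 'b) linf" where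
  "sgn_linf f = inverse (norm f) *\<^sub>R f"

definition dist_linf :: "('a, 'b) linf \<Rightarrow> ('a, 'b) linf \<Rightarrow> real" where
  "dist_linf f g = norm (f - g)"

definition uniformity_linf :: "(('a, 'b) linf \<times> ('a, 'b) linf) filter" where
  "uniformity_linf = (INF e\<in>{0<..}. principal {(f, g). dist f g < e})"

definition open_linf :: "('a, 'b) linf set \<Rightarrow> bool" where
  "open_linf U = (\<forall>f\<in>U. \<forall>\<^sub>F (f', g) in uniformity. f' = f \<longrightarrow> g \<in> U)"

lemmas linf_nth_simps =
  zero_linf.rep_eq plus_linf.rep_eq minus_linf.rep_eq uminus_linf.rep_eq scaleR_linf.rep_eq
  scaleC_linf.rep_eq

lemma norm_linf_nth_le: "norm (linf_nth f i) \<le> norm f"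
  unfolding norm_linf_def by (rule Max_ge) auto

lemma norm_linf_le: "(\<And>i. norm (linf_nth f i) \<le> b) \<Longrightarrow> norm f \<le> b"
  unfolding norm_linf_def by (subst Max_le_iff) auto

instance
proof
  fix a b :: real and c d :: complex and f g h :: "('a, 'b) linf" and U :: "('a, 'b) linf set"
  show "f + g + h = f + (g + h)" "f + g = g + f" "0 + f = f" "- f + f = 0" "f - g = f + - g"
    "a *\<^sub>R (f + g) = a *\<^sub>R f + a *\<^sub>R g" "(a + b) *\<^sub>R f = a *\<^sub>R f + b *\<^sub>R f"
    "a *\<^sub>R b *\<^sub>R f = (a * b) *\<^sub>R f" "1 *\<^sub>R f = f"
    "c *\<^sub>C (f + g) = c *\<^sub>C f + c *\<^sub>C g" "(c + d) *\<^sub>C f = c *\<^sub>C f + d *\<^sub>C f"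
    "c *\<^sub>C d *\<^sub>C f = (c * d) *\<^sub>C f" "a *\<^sub>R f = complex_of_real a *\<^sub>C f"
    by (rule linf_eqI; simp add: linf_nth_simps scaleR_add_left scaleR_add_right
        scaleC_add_left scaleC_add_right scaleC_scaleC scaleR_scaleC[symmetric] add.assoc add.commute)+
  show "dist f g = norm (f - g)" "sgn f = inverse (norm f) *\<^sub>R f"
    "uniformity = (INF e\<in>{0<..}. principal {(f::('a, 'b) linf, g). dist f g < e})"
    "open U = (\<forall>f\<in>U. \<forall>\<^sub>F (f', g) in uniformity. f' = f \<longrightarrow> g \<in> U)"
    by (fact dist_linf_def sgn_linf_def uniformity_linf_def open_linf_def)+
  show "(norm f = 0) = (f = 0)"
  proof
    assume "norm f = 0"
    with norm_linf_nth_le[of f] show "f = 0"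
      by (intro linf_eqI) (simp add: linf_nth_simps)
  qed (simp add: norm_linf_def linf_nth_simps)
  show "norm (f + g) \<le> norm f + norm g"
    by (intro norm_linf_le)
      (auto simp: linf_nth_simps intro!: order_trans[OF norm_triangle_ineq] add_mono norm_linf_nth_le)
  have le: "norm (c *\<^sub>C f) \<le> cmod c * norm f" for c and f :: "('a, 'b) linf"
    by (intro norm_linf_le)
      (auto simp: linf_nth_simps norm_scaleC intro!: mult_left_mono norm_linf_nth_le)
  have sR: "a *\<^sub>R f = complex_of_real a *\<^sub>C f" for a and f :: "('a, 'b) linf"
    by (rule linf_eqI) (simp add: linf_nth_simps scaleR_scaleC)
  show eq: "norm (c *\<^sub>C f) = cmod c * norm f" for c
  proof (cases "c = 0")
    case True
    then have "c *\<^sub>C f = 0" by (intro linf_eqI) (simp add: linf_nth_simps)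
    then show ?thesis using True by (simp add: norm_linf_def linf_nth_simps)
  next
    case False
    then have "inverse c *\<^sub>C c *\<^sub>C f = f"
      by (intro linf_eqI) (simp add: linf_nth_simps)
    with le[of "inverse c" "c *\<^sub>C f"] have "norm f \<le> inverse (cmod c) * norm (c *\<^sub>C f)"
      by (simp add: norm_inverse)
    then have "cmod c * norm f \<le> norm (c *\<^sub>C f)"
      using False by (simp add: field_simps)
    with le[of c f] show ?thesis by simp
  qed
  show "norm (a *\<^sub>R f) = \<bar>a\<bar> * norm f"
    unfolding sR eq by simp
qed

end

instance linf :: (complex_banach, finite) complex_banach
proof
  fix X :: "nat \<Rightarrow> ('a, 'b) linf" assume X: "Cauchy X"
  have diff: "norm (linf_nth (X m) i - linf_nth (X n) i) \<le> norm (X m - X n)" for m n i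
    using norm_linf_nth_le[of "X m - X n" i] by (simp add: linf_nth_simps)
  have "convergent (\<lambda>n. linf_nth (X n) i)" for i
    unfolding Cauchy_convergent_iff[symmetric]
    using X diff unfolding Cauchy_iff by (meson le_less_trans)
  then obtain L where L: "\<And>i. (\<lambda>n. linf_nth (X n) i) \<longlonglongrightarrow> L i"
    unfolding convergent_def by metis
  have Abs: "linf_nth (Abs_linf L) = L"
    by (simp add: Abs_linf_inverse)
  have "X \<longlonglongrightarrow> Abs_linf L"
  proof (rule LIMSEQ_I)
    fix e :: real assume "e > 0"
    then have "\<forall>\<^sub>F n in sequentially. norm (linf_nth (X n) i - L i) < e / 2" for i
      using tendstoD[OF L, of "e / 2" i] by (simp add: dist_norm)
    then have "\<forall>\<^sub>F n in sequentially. \<forall>i. norm (linf_nth (X n) i - L i) < e / 2"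
      by (simp add: eventually_all_finite)
    then obtain N where N: "\<And>n i. n \<ge> N \<Longrightarrow> norm (linf_nth (X n) i - L i) < e / 2"
      by (auto simp: eventually_sequentially)
    have "norm (X n - Abs_linf L) \<le> e / 2" if "n \<ge> N" for n
      using N[OF that] by (intro norm_linf_le) (simp add: linf_nth_simps Abs less_imp_le)
    with \<open>e > 0\<close> show "\<exists>N. \<forall>n\<ge>N. norm (X n - Abs_linf L) < e"
      by (intro exI[of _ N] allI impI) (fastforce intro: le_less_trans)
  qed
  then show "convergent X" by (auto simp: convergent_def)
qed

text \<open>On \<open>clinops\<close> the norm of the library type of bounded real-linear operators is the usual
  operator norm.\<close>

definition clinops ::
    "('z::complex_normed_vector \<Rightarrow>\<^sub>L 'y::complex_normed_vector) set" where
  "clinops = {T. \<forall>c z. blinfun_apply T (c *\<^sub>C z) = c *\<^sub>C blinfun_apply T z}"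

definition RSE :: "('z::complex_normed_vector \<Rightarrow>\<^sub>L 'y::complex_normed_vector) set" where
  "RSE = {T \<in> clinops. \<exists>x0 \<in> sphere 0 1.
     \<forall>x :: nat \<Rightarrow> 'z. (\<forall>n. x n \<in> cball 0 1) \<and>
         (\<lambda>n. norm (blinfun_apply T (x n))) \<longlonglongrightarrow> norm T \<longrightarrow>
       (\<exists>(\<sigma> :: nat \<Rightarrow> nat) l. strict_mono \<sigma> \<and> cmod l = 1 \<and>
         (\<lambda>n. blinfun_apply T (x (\<sigma> n))) \<longlonglongrightarrow> l *\<^sub>C blinfun_apply T x0)}"

definition BPBp_RSE ::
    "'z::complex_normed_vector itself \<Rightarrow> 'y::complex_normed_vector itself \<Rightarrow> bool" where
  "BPBp_RSE _ _ \<longleftrightarrow>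
     (\<forall>\<epsilon>>0. \<exists>\<eta>. 0 < \<eta> \<and> \<eta> < \<epsilon> \<and>
       (\<forall>T \<in> (clinops :: ('z \<Rightarrow>\<^sub>L 'y) set). \<forall>x \<in> sphere 0 1.
          norm T = 1 \<and> norm (blinfun_apply T x) > 1 - \<eta> \<longrightarrow>
          (\<exists>S \<in> RSE. \<exists>x0 \<in> sphere 0 1.
             norm S = 1 \<and> norm (blinfun_apply S x0) = 1 \<and>
             norm (S - T) < \<epsilon> \<and> norm (x - x0) < \<epsilon>)))"

definition uniformly_convex :: "'a::complex_normed_vector itself \<Rightarrow> bool" where
  "uniformly_convex _ \<longleftrightarrow>
     (\<forall>\<epsilon>>0. \<exists>\<delta>. 0 < \<delta> \<and> \<delta> < 1 \<and>
       (\<forall>x1 \<in> sphere (0 :: 'a) 1. \<forall>x2 \<in> sphere 0 1.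
          norm (x1 + x2) / 2 > 1 - \<delta> \<longrightarrow> norm (x1 - x2) < \<epsilon>))"

definition C_uniformly_convex :: "'a::complex_normed_vector itself \<Rightarrow> bool" where
  "C_uniformly_convex _ \<longleftrightarrow>
     (\<forall>\<epsilon>>0. \<exists>\<delta>>0. \<forall>y0 y1 :: 'a.
        (\<forall>w. cmod w = 1 \<longrightarrow> norm (y0 + w *\<^sub>C y1) \<le> 1) \<and> norm y1 > \<epsilon> \<longrightarrow>
        norm y0 < 1 - \<delta>)"

end

theory Submission
  imports Defs
begin

text \<open>Both spaces are treated as instances of one space \<open>Z\<close> of null families in \<open>X\<close> with the
  supremum norm, and the property of the pair \<open>(Z, Y)\<close> is shown to be equivalent to complex uniform
  convexity of \<open>Y\<close>.

  For necessity of complex uniform convexity, an operator \<open>S\<close> that exposes its range at one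
  circle of values must vanish in every direction in which a norming point can be moved both ways
  inside the ball (\<open>exposes_range_at_imp_zero\<close>). If vectors \<open>y0\<close>, \<open>y1\<close> violate complex uniform
  convexity, the operator that acts as \<open>y0\<close> on one coordinate and as \<open>y1\<close> on another nearly attains
  its norm at a vector supported on the first coordinate; the point at which a nearby \<open>S\<close> attains its
  norm can then be moved in the second coordinate, so \<open>S\<close> vanishes there and is not close to the
  given operator (\<open>BPBp_RSE_imp_C_uniformly_convex\<close>).

  Conversely, let \<open>T\<close> nearly attain its norm at \<open>x\<close>, and compose \<open>T\<close> with a functional norming
  \<open>T x\<close> to get a functional \<open>F\<close> on \<open>Z\<close> that is nearly \<open>1\<close> at \<open>x\<close>. The dual norms of the components
  of \<open>F\<close> sum to at most \<open>1\<close>, so \<open>F\<close> is nearly normed by the coordinates of \<open>x\<close> in a finite set that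
  carries most of this mass (\<open>nearly_norming_coordinates\<close>). Operators depending on finitely many
  coordinates can be approximated by operators that expose their range at a point \<open>z\<close> all of whose
  relevant coordinates have norm \<open>1\<close> (\<open>exposes_range_dense_on_coordinates\<close>): this is Lindenstrauss'
  argument, carried out with Baire's theorem (\<open>exposes_range_dense\<close>), and it uses that such points
  are uniformly strongly exposed in the ball. Applied to \<open>T\<close> plus a small multiple of
  \<open>F \<otimes> T x\<close>, it produces a \<open>z\<close> at which \<open>F\<close> is again nearly \<open>1\<close>. Uniform convexity of \<open>X\<close> makes
  \<open>x\<close> and \<open>z\<close> close on the coordinates \<open>E\<close> where both nearly norm \<open>F\<close>. Off \<open>E\<close> they may differ, but
  \<open>T\<close> nearly attains its norm already at the part of \<open>z\<close> in \<open>E\<close>, and complex uniform convexity of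
  \<open>Y\<close> makes \<open>T\<close> small on everything else (\<open>operator_small_off_support\<close>). Hence the exposing
  operator can be modified off \<open>E\<close> so as to expose its range at the point that agrees with \<open>z\<close> on
  \<open>E\<close> and with \<open>x\<close> elsewhere (\<open>exposes_range_transfer\<close>).\<close>

section \<open>Norming functionals\<close>

definition dominated_sublinear :: "('a::real_normed_vector \<Rightarrow> real) \<Rightarrow> bool" where
  "dominated_sublinear q \<longleftrightarrow> (\<forall>v. q v \<le> norm v) \<and> (\<forall>u v. q (u + v) \<le> q u + q v) \<and>
     (\<forall>r\<ge>0. \<forall>v. q (r *\<^sub>R v) = r * q v)"

lemma dominated_sublinearD:
  assumes "dominated_sublinear q"
  shows "q v \<le> norm v" "q (u + v) \<le> q u + q v" "r \<ge> 0 \<Longrightarrow> q (r *\<^sub>R v) = r * q v"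
    "q 0 = 0" "- norm v \<le> q v" "- q (- v) \<le> q v"
proof -
  show 1: "q v \<le> norm v" "q (u + v) \<le> q u + q v" "r \<ge> 0 \<Longrightarrow> q (r *\<^sub>R v) = r * q v" for u v r
    using assms by (auto simp: dominated_sublinear_def)
  show 0: "q 0 = 0" using 1(3)[of 0 0] by simp
  show "- q (- v) \<le> q v" using 1(2)[of v "- v"] 0 by simp
  with 1(1)[of "- v"] show "- norm v \<le> q v" by simp
qed

lemma dominated_sublinear_norm: "dominated_sublinear norm"
  by (simp add: dominated_sublinear_def norm_triangle_ineq)

text \<open>Lowering a sublinear functional as far as possible along the ray of \<open>x\<close> keeps it sublinear
  and makes its value at \<open>- x\<close> opposite to the old value at \<open>x\<close>. A minimal sublinear functional
  cannot be lowered, hence is linear.\<close>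

lemma lower_sublinear:
  assumes q: "dominated_sublinear q"
  obtains p where "dominated_sublinear p" "\<And>v. p v \<le> q v" "\<And>v. p v \<le> q (v + x) - q x"
proof -
  note qD = dominated_sublinearD[OF q]
  define p where "p v = (INF t\<in>{0..}. q (v + t *\<^sub>R x) - t * q x)" for v
  have lower: "- q (- v) \<le> q (v + t *\<^sub>R x) - t * q x" if "t \<ge> 0" for v t
    using qD(2)[of "v + t *\<^sub>R x" "- v"] qD(3)[OF that, of x] by simp
  have p_le: "p v \<le> q (v + t *\<^sub>R x) - t * q x" if "t \<ge> 0" for v t
    unfolding p_def using lower that by (intro cINF_lower) (auto intro!: bdd_belowI2)
  have p_ge: "b \<le> p v" if "\<And>t. t \<ge> 0 \<Longrightarrow> b \<le> q (v + t *\<^sub>R x) - t * q x" for b v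
    unfolding p_def using that by (intro cINF_greatest) auto
  have p_le_q: "p v \<le> q v" for v using p_le[of 0 v] by simp
  have hom: "p (r *\<^sub>R v) \<le> r * p v" if "r > 0" for r v
  proof -
    have "p (r *\<^sub>R v) / r \<le> p v"
    proof (rule p_ge)
      fix t :: real assume t: "t \<ge> 0"
      have "p (r *\<^sub>R v) \<le> q (r *\<^sub>R v + (r * t) *\<^sub>R x) - (r * t) * q x"
        using that t by (intro p_le) auto
      also have "r *\<^sub>R v + (r * t) *\<^sub>R x = r *\<^sub>R (v + t *\<^sub>R x)" by (simp add: scaleR_add_right)
      also have "q \<dots> - (r * t) * q x = r * (q (v + t *\<^sub>R x) - t * q x)"
        using that qD(3)[of r "v + t *\<^sub>R x"] by (simp add: right_diff_distrib)
      finally show "p (r *\<^sub>R v) / r \<le> q (v + t *\<^sub>R x) - t * q x"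
        using that by (simp add: field_simps)
    qed
    then show ?thesis using that by (simp add: field_simps)
  qed
  have "dominated_sublinear p"
    unfolding dominated_sublinear_def
  proof (intro conjI allI impI)
    show "p v \<le> norm v" for v using p_le_q[of v] qD(1)[of v] by simp
    show "p (u + v) \<le> p u + p v" for u v
    proof -
      have "p (u + v) - p v \<le> p u"
      proof (rule p_ge)
        fix s :: real assume s: "s \<ge> 0"
        have "p (u + v) - (q (u + s *\<^sub>R x) - s * q x) \<le> p v"
        proof (rule p_ge)
          fix t :: real assume t: "t \<ge> 0"
          have "p (u + v) \<le> q ((u + s *\<^sub>R x) + (v + t *\<^sub>R x)) - (s + t) * q x"
            using p_le[of "s + t" "u + v"] s t by (simp add: scaleR_add_left algebra_simps)
          also have "\<dots> \<le> q (u + s *\<^sub>R x) + q (v + t *\<^sub>R x) - (s + t) * q x"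
            using qD(2) by simp
          finally show "p (u + v) - (q (u + s *\<^sub>R x) - s * q x) \<le> q (v + t *\<^sub>R x) - t * q x"
            by (simp add: algebra_simps)
        qed
        then show "p (u + v) - p v \<le> q (u + s *\<^sub>R x) - s * q x" by simp
      qed
      then show ?thesis by simp
    qed
    fix r :: real and v assume "r \<ge> 0"
    show "p (r *\<^sub>R v) = r * p v"
    proof (cases "r = 0")
      case True
      have "0 \<le> p 0" using qD(3)[of _ x] by (intro p_ge) auto
      with p_le_q[of 0] qD(4) True show ?thesis by simp
    next
      case False
      with \<open>r \<ge> 0\<close> have r: "r > 0" by simp
      have "p v \<le> (1 / r) * p (r *\<^sub>R v)" using hom[of "1 / r" "r *\<^sub>R v"] r by simp
      with hom[OF r, of v] r show ?thesis by (simp add: field_simps)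
    qed
  qed
  then show thesis using p_le_q p_le[of 1] by (intro that[of p]) auto
qed

text \<open>The pointwise infimum of a chain of sublinear functionals is sublinear, and the bound by the
  norm keeps it finite, so Zorn's lemma applies.\<close>

lemma dominated_sublinear_minimal:
  assumes "dominated_sublinear (p :: 'a::real_normed_vector \<Rightarrow> real)"
  obtains m where "dominated_sublinear m" "\<And>v. m v \<le> p v"
    "\<And>q. dominated_sublinear q \<Longrightarrow> (\<And>v. q v \<le> m v) \<Longrightarrow> q = m"
proof -
  let ?A = "{q. dominated_sublinear q \<and> q \<le> p}"
  let ?P = "\<lambda>a b. b \<le> (a :: 'a \<Rightarrow> real)"
  have "\<exists>m\<in>?A. \<forall>a\<in>?A. ?P m a \<longrightarrow> a = m"
  proof (rule predicate_Zorn)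
    show "partial_order_on ?A (relation_of ?P ?A)"
      unfolding partial_order_on_def preorder_on_def refl_on_def trans_def antisym_def relation_of_def
      by auto
    fix C assume C: "C \<in> Chains (relation_of ?P ?A)"
    then have sub: "q \<in> ?A" if "q \<in> C" for q using Chains_relation_of that by blast
    note D = dominated_sublinearD
    show "\<exists>u\<in>?A. \<forall>a\<in>C. ?P a u"
    proof (cases "C = {}")
      case True
      then show ?thesis using assms by auto
    next
      case False
      define u where "u v = (INF q\<in>C. q v)" for v
      have le: "u v \<le> q v" if "q \<in> C" for q v
        unfolding u_def using sub that D(5) by (intro cINF_lower) (auto intro!: bdd_belowI2)
      have ge: "b \<le> u v" if "\<And>q. q \<in> C \<Longrightarrow> b \<le> q v" for b v
        unfolding u_def using that False by (intro cINF_greatest) auto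
      have cmp: "q1 \<le> q2 \<or> q2 \<le> q1" if "q1 \<in> C" "q2 \<in> C" for q1 q2
        using C that unfolding Chains_def relation_of_def by auto
      from False obtain q0 where q0: "q0 \<in> C" by auto
      have hom: "u (r *\<^sub>R v) \<le> r * u v" if "r > 0" for r v
      proof -
        have "u (r *\<^sub>R v) / r \<le> u v"
        proof (rule ge)
          fix q assume q: "q \<in> C"
          with le[OF q, of "r *\<^sub>R v"] sub[OF q] D(3)[of q r v] that
          show "u (r *\<^sub>R v) / r \<le> q v" by (simp add: field_simps)
        qed
        then show ?thesis using that by (simp add: field_simps)
      qed
      have "dominated_sublinear u"
        unfolding dominated_sublinear_def
      proof (intro conjI allI impI)
        show "u v \<le> norm v" for v
          using le[OF q0, of v] sub[OF q0] D(1)[of q0 v] by auto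
        show "u (v + w) \<le> u v + u w" for v w
        proof -
          have "u (v + w) - u w \<le> u v"
          proof (rule ge)
            fix q assume q: "q \<in> C"
            have "u (v + w) - q v \<le> u w"
            proof (rule ge)
              fix q' assume q': "q' \<in> C"
              have "\<exists>r\<in>C. r \<le> q \<and> r \<le> q'" using cmp[OF q q'] q q' by blast
              then obtain r where r: "r \<in> C" "r \<le> q" "r \<le> q'" by blast
              have "u (v + w) \<le> r v + r w"
                using le[OF r(1), of "v + w"] sub[OF r(1)] D(2)[of r v w] by auto
              also have "\<dots> \<le> q v + q' w" using r(2,3) by (simp add: le_fun_def add_mono)
              finally show "u (v + w) - q v \<le> q' w" by simp
            qed
            then show "u (v + w) - u w \<le> q v" by simp
          qed
          then show ?thesis by simp
        qed
        fix r :: real and v assume "r \<ge> 0"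
        show "u (r *\<^sub>R v) = r * u v"
        proof (cases "r = 0")
          case True
          have "u 0 = 0"
          proof (rule antisym)
            show "u 0 \<le> 0" using le[OF q0, of 0] sub[OF q0] D(4)[of q0] by auto
            show "0 \<le> u 0"
            proof (rule ge)
              show "0 \<le> q 0" if "q \<in> C" for q using sub[OF that] D(4)[of q] by auto
            qed
          qed
          with True show ?thesis by simp
        next
          case False
          with \<open>r \<ge> 0\<close> have r: "r > 0" by simp
          have "u v \<le> (1 / r) * u (r *\<^sub>R v)" using hom[of "1 / r" "r *\<^sub>R v"] r by simp
          with hom[OF r, of v] r show ?thesis by (simp add: field_simps)
        qed
      qed
      moreover have "u \<le> p" using le[OF q0] sub[OF q0] by (auto simp: le_fun_def intro: order_trans)
      ultimately show ?thesis using le by (auto simp: le_fun_def)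
    qed
  qed
  then obtain m where m: "dominated_sublinear m" "m \<le> p"
    "\<And>a. dominated_sublinear a \<Longrightarrow> a \<le> p \<Longrightarrow> a \<le> m \<Longrightarrow> a = m"
    by auto
  have "a = m" if "dominated_sublinear a" "\<And>v. a v \<le> m v" for a
    using m(2) m(3)[of a] that by (meson le_funI order_trans)
  then show thesis using m(1,2) by (intro that[of m]) (auto simp: le_fun_def)
qed

lemma real_norming_functional:
  fixes x :: "'a::real_normed_vector"
  obtains q where "linear q" "\<And>v. q v \<le> norm v" "q x = norm x"
proof -
  obtain p where p: "dominated_sublinear p" "\<And>v. p v \<le> norm (v + x) - norm x"
    using lower_sublinear[OF dominated_sublinear_norm, of x] by metis
  obtain m where m: "dominated_sublinear m" "\<And>v. m v \<le> p v"
    and min: "\<And>q. dominated_sublinear q \<Longrightarrow> (\<And>v. q v \<le> m v) \<Longrightarrow> q = m"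
    using dominated_sublinear_minimal[OF p(1)] by metis
  note D = dominated_sublinearD[OF m(1)]
  have add: "m (u + v) = m u + m v" for u v
  proof -
    obtain q where q: "dominated_sublinear q" "\<And>w. q w \<le> m w" "\<And>w. q w \<le> m (w + v) - m v"
      using lower_sublinear[OF m(1), of v] by metis
    have "q = m" using min q by blast
    with q(3)[of u] D(2)[of u v] show ?thesis by simp
  qed
  have neg: "m (- v) = - m v" for v using add[of v "- v"] D(4) by simp
  show thesis
  proof (rule that)
    show "linear m"
    proof (rule linearI)
      show "m (u + v) = m u + m v" for u v by (rule add)
      show "m (r *\<^sub>R v) = r *\<^sub>R m v" for r v
      proof (cases "r \<ge> 0")
        case False
        then have "m (- r *\<^sub>R v) = - r * m v" by (intro D(3)) simp
        then show ?thesis using neg[of "r *\<^sub>R v"] by simp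
      qed (simp add: D(3))
    qed
    show "m v \<le> norm v" for v by (rule D(1))
    show "m x = norm x"
      using m(2)[of "- x"] p(2)[of "- x"] neg[of x] D(1)[of x] by simp
  qed
qed

definition clinear_functional :: "('a::complex_normed_vector \<Rightarrow> complex) \<Rightarrow> bool" where
  "clinear_functional f \<longleftrightarrow> bounded_linear f \<and> (\<forall>c v. f (c *\<^sub>C v) = c * f v)"



lemma exists_unit_rotation: "\<exists>w. cmod w = 1 \<and> w * z = cmod z"
proof (cases "z = 0")
  case False
  then show ?thesis
    by (intro exI[of _ "cnj (sgn z)"])
      (auto simp: norm_sgn sgn_eq norm_divide complex_norm_square[symmetric] power2_eq_square
        mult.commute)
qed (auto intro: exI[of _ 1])

text \<open>The complex functional with real part \<open>q\<close> is \<open>v \<mapsto> q v - i q (i v)\<close>; rotating the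
  argument until the value is real transfers the bound from \<open>q\<close>.\<close>

theorem norming_functional:
  fixes x :: "'a::complex_normed_vector"
  obtains f where "clinear_functional f" "\<And>v. cmod (f v) \<le> norm v" "f x = norm x"
proof -
  obtain q where q: "linear q" "\<And>v. q v \<le> norm v" "q x = norm x"
    using real_norming_functional by blast
  note qs = linear_add[OF q(1)] linear_cmul[OF q(1)] linear_neg[OF q(1)]
  define f where "f v = Complex (q v) (- q (\<i> *\<^sub>C v))" for v
  have ii: "\<i> *\<^sub>C \<i> *\<^sub>C v = - v" for v :: 'a by (simp add: scaleC_scaleC)
  have add: "f (u + v) = f u + f v" for u v
    by (simp add: f_def qs scaleC_add_right complex_eq_iff)
  have scale: "f (c *\<^sub>C v) = c * f v" for c v
  proof -
    have c: "c *\<^sub>C v = Re c *\<^sub>R v + Im c *\<^sub>R (\<i> *\<^sub>C v)" for v :: 'a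
      by (simp add: scaleR_scaleC scaleC_scaleC scaleC_add_left[symmetric])
        (metis complex_eq mult.commute)
    have "\<i> *\<^sub>C c *\<^sub>C v = c *\<^sub>C \<i> *\<^sub>C v" by (simp add: scaleC_scaleC mult.commute)
    also have "\<dots> = Re c *\<^sub>R (\<i> *\<^sub>C v) - Im c *\<^sub>R v" using c[of "\<i> *\<^sub>C v"] ii[of v] by simp
    finally have "q (\<i> *\<^sub>C c *\<^sub>C v) = Re c * q (\<i> *\<^sub>C v) - Im c * q v"
      by (simp add: linear_diff[OF q(1)] qs)
    moreover have "q (c *\<^sub>C v) = Re c * q v + Im c * q (\<i> *\<^sub>C v)"
      unfolding c[of v] by (simp add: qs)
    ultimately show ?thesis by (simp add: f_def complex_eq_iff)
  qed
  have le: "cmod (f v) \<le> norm v" for v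
  proof -
    obtain w where w: "cmod w = 1" "w * f v = cmod (f v)" using exists_unit_rotation by blast
    have "cmod (f v) = Re (f (w *\<^sub>C v))" using w(2) scale[of w v] by simp
    also have "\<dots> \<le> norm (w *\<^sub>C v)" unfolding f_def using q(2) by simp
    finally show ?thesis using w(1) by (simp add: norm_scaleC)
  qed
  have "f (r *\<^sub>R v) = r *\<^sub>R f v" for r v
    using scale[of "complex_of_real r" v] by (simp add: scaleR_scaleC scaleR_conv_of_real)
  then have "bounded_linear f"
    using add le by (intro bounded_linear_intro[of f 1]) auto
  moreover have "f x = norm x"
  proof -
    have "Re (f x) = norm x" by (simp add: f_def q(3))
    moreover have "(cmod (f x))\<^sup>2 \<le> (norm x)\<^sup>2" using le[of x] by (intro power_mono) auto
    ultimately have "Im (f x) = 0" by (simp add: cmod_power2)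
    with \<open>Re (f x) = norm x\<close> show ?thesis by (simp add: complex_eq_iff)
  qed
  ultimately show thesis using scale le by (intro that[of f]) (auto simp: clinear_functional_def)
qed

section \<open>Complex-linear operators\<close>

lemma bounded_linear_scaleC: "bounded_linear (\<lambda>v :: 'a::complex_normed_vector. c *\<^sub>C v)"
proof (rule bounded_linear_intro[of _ "cmod c"])
  show "c *\<^sub>C (r *\<^sub>R v) = r *\<^sub>R (c *\<^sub>C v)" for r and v :: 'a
    by (simp add: scaleR_scaleC scaleC_scaleC mult.commute)
qed (simp_all add: scaleC_add_right norm_scaleC mult.commute)

lemma bounded_linear_scaleC_left: "bounded_linear (\<lambda>c. c *\<^sub>C (v :: 'a::complex_normed_vector))"
  by (rule bounded_linear_intro[of _ "norm v"])
    (simp_all add: scaleC_add_left norm_scaleC scaleR_scaleC scaleC_scaleC scaleR_conv_of_real)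



lemma clinopsD: "T \<in> clinops \<Longrightarrow> T (c *\<^sub>C v) = c *\<^sub>C T v"
  by (simp add: clinops_def)

lemma obtain_clinop:
  assumes "bounded_linear f" "\<And>c v. f (c *\<^sub>C v) = c *\<^sub>C f v"
  obtains S where "S \<in> clinops" "blinfun_apply S = f"
  using assms by (intro that[of "Blinfun f"]) (auto simp: clinops_def bounded_linear_Blinfun_apply)

lemma clinear_functionalD:
  assumes "clinear_functional f"
  shows "bounded_linear f" "f (c *\<^sub>C v) = c * f v" "f (u + v) = f u + f v" "f (u - v) = f u - f v"
    "f (- v) = - f v" "f 0 = 0" "f (r *\<^sub>R v) = r *\<^sub>R f v"
proof -
  show f: "bounded_linear f" "f (c *\<^sub>C v) = c * f v"
    using assms by (auto simp: clinear_functional_def)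
  note lin = bounded_linear.linear[OF f(1)]
  show "f (u + v) = f u + f v" "f (u - v) = f u - f v" "f (- v) = - f v" "f 0 = 0"
    "f (r *\<^sub>R v) = r *\<^sub>R f v"
    using linear_add[OF lin] linear_diff[OF lin] linear_neg[OF lin] linear_0[OF lin]
      linear_cmul[OF lin] by auto
qed

lemma bounded_linear_rank_one:
  fixes y :: "'b::complex_normed_vector"
  assumes "clinear_functional f"
  shows "bounded_linear (\<lambda>v. f v *\<^sub>C y)"
  using bounded_linear_compose[OF bounded_linear_scaleC_left clinear_functionalD(1)[OF assms]] .

lemma norm_blinfun_le: "norm v \<le> 1 \<Longrightarrow> norm (blinfun_apply T v) \<le> norm T"
  using norm_blinfun[of T v] mult_left_mono[of "norm v" 1 "norm T"] by simp

lemma norm_blinfun_boundI: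
  assumes "\<And>v. norm v \<le> 1 \<Longrightarrow> norm (blinfun_apply T v) \<le> b"
  shows "norm T \<le> b"
proof (rule norm_blinfun_bound)
  show "0 \<le> b" using assms[of 0] by simp
  fix v
  show "norm (T v) \<le> b * norm v"
  proof (cases "v = 0")
    case False
    then show ?thesis
      using assms[of "(1 / norm v) *\<^sub>R v"] by (simp add: blinfun.scaleR_right field_simps)
  qed simp
qed

lemma norm_blinfun_nearly_attained:
  fixes T :: "'a::real_normed_vector \<Rightarrow>\<^sub>L 'b::real_normed_vector"
  assumes "e > 0"
  obtains v where "norm v \<le> 1" "norm (T v) > norm T - e"
proof (rule ccontr)
  assume "\<not> thesis"
  then have "norm T \<le> norm T - e" by (intro norm_blinfun_boundI) (meson not_less that)
  with assms show False by simp
qed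

lemma inverse_rotation:
  assumes "cmod l = 1"
  shows "cmod (inverse l) = 1" "inverse l * l = 1" "l * inverse l = 1"
proof -
  have "l \<noteq> 0" using assms by auto
  then show "cmod (inverse l) = 1" "inverse l * l = 1" "l * inverse l = 1"
    using assms by (auto simp: norm_inverse)
qed

section \<open>Uniform convexity in the ball\<close>

lemma uniformly_convex_ball:
  assumes uc: "uniformly_convex TYPE('a::complex_normed_vector)" and e: "e > 0"
  obtains d where "d > 0" "d \<le> 1 / 4"
    "\<And>a b :: 'a. norm a \<le> 1 \<Longrightarrow> norm b \<le> 1 \<Longrightarrow> norm (a + b) / 2 > 1 - d \<Longrightarrow> norm (a - b) < e"
proof -
  obtain d where d: "d > 0" "\<And>x y :: 'a. norm x = 1 \<Longrightarrow> norm y = 1 \<Longrightarrow>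
      norm (x + y) / 2 > 1 - d \<Longrightarrow> norm (x - y) < e / 2"
    using uc e unfolding uniformly_convex_def by (metis half_gt_zero mem_sphere_0)
  define g where "g = Min {d / 3, e / 8, 1 / 4}"
  have g: "g > 0" "g \<le> d / 3" "g \<le> e / 8" "g \<le> 1 / 4" using d e by (auto simp: g_def)
  have main: "norm (a - b) < e"
    if ab: "norm a \<le> 1" "norm b \<le> 1" "norm (a + b) / 2 > 1 - g" for a b :: 'a
  proof -
    have n: "norm a > 1 - 2 * g" "norm b > 1 - 2 * g"
      using ab norm_triangle_ineq[of a b] by (auto simp: field_simps)
    define x y where "x = sgn a" and "y = sgn b"
    have nz: "a \<noteq> 0" "b \<noteq> 0" using n g(4) by auto
    have close: "norm (c - sgn c) < 2 * g" if "norm c \<le> 1" "norm c > 1 - 2 * g" "c \<noteq> 0" for c :: 'a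
    proof -
      have "c - sgn c = (norm c - 1) *\<^sub>R sgn c"
        using that(3) by (simp add: sgn_div_norm scaleR_left_diff_distrib left_diff_distrib)
      then have "norm (c - sgn c) = \<bar>norm c - 1\<bar>" using that(3) by (simp add: norm_sgn)
      with that show ?thesis by simp
    qed
    have c: "norm (a - x) < 2 * g" "norm (b - y) < 2 * g"
      using close n ab nz by (auto simp: x_def y_def)
    have "norm (a + b) \<le> norm (x + y) + norm (a - x) + norm (b - y)"
      using norm_triangle_ineq[of "x + y" "(a - x) + (b - y)"] norm_triangle_ineq[of "a - x" "b - y"]
      by (simp add: algebra_simps)
    then have "norm (x + y) / 2 > 1 - d" using c ab(3) g by (simp add: field_simps)
    then have "norm (x - y) < e / 2" using nz by (intro d) (auto simp: x_def y_def norm_sgn)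
    moreover have "norm (a - b) \<le> norm (x - y) + norm (a - x) + norm (b - y)"
      using norm_triangle_ineq[of "x - y" "(a - x) - (b - y)"] norm_triangle_ineq4[of "a - x" "b - y"]
      by (simp add: algebra_simps)
    ultimately show ?thesis using c g(3) by simp
  qed
  show thesis by (rule that[OF g(1,4) main])
qed

text \<open>A functional that nearly attains its norm at two points of the ball nearly attains it at
  their midpoint, so the two points are close.\<close>

lemma uniformly_convex_slice:
  assumes uc: "uniformly_convex TYPE('a::complex_normed_vector)" and e: "e > 0"
  obtains g where "g > 0" "g \<le> 1 / 4"
    "\<And>f s a b. clinear_functional f \<Longrightarrow> (\<And>v :: 'a. cmod (f v) \<le> s * norm v) \<Longrightarrow> 0 \<le> s \<Longrightarrow>
       norm a \<le> 1 \<Longrightarrow> norm b \<le> 1 \<Longrightarrow> Re (f a) > (1 - g) * s \<Longrightarrow> Re (f b) > (1 - g) * s \<Longrightarrow>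
       norm (a - b) < e"
proof -
  obtain g where g: "g > 0" "g \<le> 1 / 4"
    "\<And>a b :: 'a. norm a \<le> 1 \<Longrightarrow> norm b \<le> 1 \<Longrightarrow> norm (a + b) / 2 > 1 - g \<Longrightarrow> norm (a - b) < e"
    using uniformly_convex_ball[OF uc e] by blast
  show thesis
  proof (rule that[OF g(1,2)])
    fix f s and a b :: 'a
    assume f: "clinear_functional f" "\<And>v. cmod (f v) \<le> s * norm v" and s: "0 \<le> s"
      and ab: "norm a \<le> 1" "norm b \<le> 1" "Re (f a) > (1 - g) * s" "Re (f b) > (1 - g) * s"
    have "Re (f (a + b)) > 2 * (1 - g) * s" using ab clinear_functionalD(3)[OF f(1)]
      by (simp add: algebra_simps)
    with f(2)[of "a + b"] complex_Re_le_cmod[of "f (a + b)"]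
    have lt: "2 * (1 - g) * s < s * norm (a + b)" by linarith
    with s have "s > 0" by (cases "s = 0") auto
    with lt have "2 * (1 - g) < norm (a + b)" by (simp add: mult.commute)
    with ab g show "norm (a - b) < e" by simp
  qed
qed

section \<open>Density of operators that expose their range\<close>

definition exposes_range_at ::
    "('z::complex_normed_vector \<Rightarrow>\<^sub>L 'y::complex_normed_vector) \<Rightarrow> 'z \<Rightarrow> bool" where
  "exposes_range_at T z \<longleftrightarrow>
     (\<forall>x. (\<forall>n. norm (x n) \<le> 1) \<and> (\<lambda>n. norm (T (x n))) \<longlonglongrightarrow> norm T \<longrightarrow>
       (\<exists>(\<sigma> :: nat \<Rightarrow> nat) l. strict_mono \<sigma> \<and> cmod l = 1 \<and> (\<lambda>n. T (x (\<sigma> n))) \<longlonglongrightarrow> l *\<^sub>C T z))"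

lemma RSE_iff: "T \<in> RSE \<longleftrightarrow> T \<in> clinops \<and> (\<exists>z. norm z = 1 \<and> exposes_range_at T z)"
  unfolding RSE_def exposes_range_at_def by (simp add: Bex_def)

lemma exposes_range_at_rotate:
  assumes T: "T \<in> clinops" "exposes_range_at T z" and w: "cmod w = 1"
  shows "exposes_range_at T (w *\<^sub>C z)"
  unfolding exposes_range_at_def
proof (intro allI impI)
  fix x :: "nat \<Rightarrow> 'a"
  assume "(\<forall>n. norm (x n) \<le> 1) \<and> (\<lambda>n. norm (T (x n))) \<longlonglongrightarrow> norm T"
  then obtain \<sigma> :: "nat \<Rightarrow> nat" and l where
    *: "strict_mono \<sigma>" "cmod l = 1" "(\<lambda>n. T (x (\<sigma> n))) \<longlonglongrightarrow> l *\<^sub>C T z"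
    using T(2) unfolding exposes_range_at_def by blast
  have "(l * inverse w) *\<^sub>C T (w *\<^sub>C z) = l *\<^sub>C T z"
    using inverse_rotation[OF w] by (simp add: clinopsD[OF T(1)] scaleC_scaleC mult.assoc)
  then show "\<exists>\<sigma> l. strict_mono \<sigma> \<and> cmod l = 1 \<and> (\<lambda>n. T (x (\<sigma> n))) \<longlonglongrightarrow> l *\<^sub>C T (w *\<^sub>C z)"
    using * inverse_rotation(1)[OF w]
    by (intro exI[of _ \<sigma>] exI[of _ "l * inverse w"]) (simp add: norm_mult)
qed

lemma Baire_closed_subset:
  fixes M :: "'a::complete_space set" and D :: "nat \<Rightarrow> 'a set"
  assumes "closed M" and "\<And>k. openin (top_of_set M) (D k)"
    and dense: "\<And>k x e. x \<in> M \<Longrightarrow> e > 0 \<Longrightarrow> \<exists>y\<in>D k. dist y x < e"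
    and x: "x \<in> M" and e: "e > 0"
  shows "\<exists>y\<in>M. (\<forall>k. y \<in> D k) \<and> dist y x < e"
proof -
  have sub: "D k \<subseteq> M" for k using assms(2) openin_imp_subset by blast
  have clos: "top_of_set M closure_of A = M \<inter> closure A" if "A \<subseteq> M" for A
    using that by (simp add: closure_of_subtopology Int_absorb1)
  have "top_of_set M closure_of \<Inter>(range D) = topspace (top_of_set M)"
  proof (rule Baire_category)
    show "completely_metrizable_space (top_of_set M) \<or>
        locally_compact_space (top_of_set M) \<and> regular_space (top_of_set M)"
      using completely_metrizable_space_closedin[OF completely_metrizable_space_euclidean] assms(1)
      by auto
    fix A assume "A \<in> range D"
    then obtain k where A: "A = D k" by auto
    have "M \<subseteq> closure (D k)" using dense by (auto simp: closure_approachable)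
    with A clos[OF sub] assms(2) show "openin (top_of_set M) A \<and>
        top_of_set M closure_of A = topspace (top_of_set M)" by auto
  qed simp
  moreover have "\<Inter>(range D) \<subseteq> M" using sub by auto
  ultimately have "x \<in> closure (\<Inter>(range D))" using clos x by auto
  then obtain y where "y \<in> \<Inter>(range D)" "dist y x < e" using e by (auto simp: closure_approachable)
  with sub show ?thesis by blast
qed

lemma closed_clinops_invariant:
  fixes P :: "'z::complex_normed_vector \<Rightarrow> 'z"
  shows "closed {T \<in> clinops :: ('z \<Rightarrow>\<^sub>L 'y::complex_normed_vector) set. \<forall>v. T (P v) = T v}"
proof -
  have ap: "continuous_on UNIV (\<lambda>T :: 'z \<Rightarrow>\<^sub>L 'y. T v)" for v
    by (intro linear_continuous_on blinfun.bounded_linear_left)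
  have sc: "continuous_on UNIV (\<lambda>T :: 'z \<Rightarrow>\<^sub>L 'y. c *\<^sub>C T v)" for v c
    by (intro linear_continuous_on bounded_linear_compose[OF bounded_linear_scaleC
          blinfun.bounded_linear_left])
  show ?thesis
    unfolding clinops_def by (simp, intro closed_Collect_conj closed_Collect_all closed_Collect_eq ap sc)
qed

text \<open>Perturbing \<open>S\<close> by a small multiple of \<open>\<Phi> z \<otimes> S z\<close>, where \<open>z \<in> U\<close> nearly norms \<open>S\<close>,
  confines the points that nearly norm the new operator to those where \<open>\<Phi> z\<close> is nearly \<open>1\<close> in
  modulus, that is to small neighbourhoods of the circle of \<open>z\<close>. This confinement to a given
  radius persists under small perturbations, so Baire's theorem gives operators confined to
  every radius: their nearly norming sequences converge up to rotation.\<close>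

theorem exposes_range_dense:
  fixes T :: "'z::complex_banach \<Rightarrow>\<^sub>L 'y::complex_banach" and P :: "'z \<Rightarrow> 'z"
  assumes T: "T \<in> clinops" "\<And>v. T (P v) = T v" "T \<noteq> 0" and \<kappa>: "\<kappa> > 0"
    and U: "\<And>z. z \<in> U \<Longrightarrow> norm z \<le> 1 \<and> P z = z" "closed U"
      "\<And>z w. z \<in> U \<Longrightarrow> cmod w = 1 \<Longrightarrow> w *\<^sub>C z \<in> U"
    and norming: "\<And>S e. S \<in> clinops \<Longrightarrow> (\<And>v. S (P v) = S v) \<Longrightarrow> e > 0 \<Longrightarrow>
      \<exists>z\<in>U. norm (blinfun_apply (S :: 'z \<Rightarrow>\<^sub>L 'y) z) > norm S - e"
    and \<Phi>: "\<And>z. z \<in> U \<Longrightarrow> clinear_functional (\<Phi> z)" "\<And>z v. z \<in> U \<Longrightarrow> cmod (\<Phi> z v) \<le> norm v"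
      "\<And>z. z \<in> U \<Longrightarrow> \<Phi> z z = 1" "\<And>z v. z \<in> U \<Longrightarrow> \<Phi> z (P v) = \<Phi> z v"
    and exposed: "\<And>e. e > 0 \<Longrightarrow> \<exists>d>0. \<forall>z\<in>U. \<forall>v. norm v \<le> 1 \<longrightarrow> cmod (\<Phi> z v) > 1 - d \<longrightarrow>
      (\<exists>l. cmod l = 1 \<and> norm (P v - l *\<^sub>C z) < e)"
  obtains S z where "S \<in> clinops" "\<And>v. S (P v) = S v" "norm (S - T) < \<kappa>"
    "z \<in> U" "norm (S z) = norm S" "exposes_range_at S z"
proof -
  define M where "M = {S \<in> clinops :: ('z \<Rightarrow>\<^sub>L 'y) set. \<forall>v. S (P v) = S v}"
  define conf where "conf S e z \<xi> \<longleftrightarrow> (\<forall>v. norm v \<le> 1 \<longrightarrow> norm (blinfun_apply S v) > norm S - \<xi> \<longrightarrow>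
      (\<exists>l. cmod l = 1 \<and> norm (P v - l *\<^sub>C z) < e))" for S :: "'z \<Rightarrow>\<^sub>L 'y" and e z \<xi>
  define D where "D k = {S \<in> M. \<exists>z\<in>U. \<exists>\<xi>>0. conf S ((1/2) ^ k) z \<xi>}" for k :: nat
  have "closed M" unfolding M_def by (rule closed_clinops_invariant)
  have MD: "S \<in> clinops" "S (P v) = S v" if "S \<in> M" for S v using that by (auto simp: M_def)
  have "openin (top_of_set M) (D k)" for k
    unfolding openin_euclidean_subtopology_iff
  proof (intro conjI ballI)
    show "D k \<subseteq> M" by (auto simp: D_def)
    fix S assume "S \<in> D k"
    then obtain z \<xi> where *: "z \<in> U" "\<xi> > 0" "conf S ((1/2) ^ k) z \<xi>" by (auto simp: D_def)
    have "S' \<in> D k" if S': "S' \<in> M" "dist S' S < \<xi> / 4" for S'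
    proof -
      have "conf S' ((1/2) ^ k) z (\<xi> / 2)"
        unfolding conf_def
      proof (intro allI impI)
        fix v assume v: "norm v \<le> 1" "norm S' - \<xi> / 2 < norm (S' v)"
        have "norm (S' v - S v) \<le> norm (S' - S)"
          using norm_blinfun_le[OF v(1), of "S' - S"] by (simp add: blinfun.diff_left)
        moreover have "norm S - norm S' \<le> norm (S' - S)" by (metis norm_minus_commute norm_triangle_ineq2)
        moreover have "norm (S' v) \<le> norm (S v) + norm (S' v - S v)" by (rule norm_triangle_sub)
        ultimately have "norm S - \<xi> < norm (S v)" using v(2) S'(2) by (simp add: dist_norm)
        with * v(1) show "\<exists>l. cmod l = 1 \<and> norm (P v - l *\<^sub>C z) < (1/2) ^ k"
          unfolding conf_def by blast
      qed
      then show ?thesis unfolding D_def using * S'(1) by (auto intro!: exI[of _ "\<xi> / 2"])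
    qed
    then show "\<exists>e>0. \<forall>S'\<in>M. dist S' S < e \<longrightarrow> S' \<in> D k"
      using *(2) by (intro exI[of _ "\<xi> / 4"]) auto
  qed
  moreover have "\<exists>S'\<in>D k. dist S' S < e" if "S \<in> M" "e > 0" for k S e
  proof -
    have step: "\<exists>S'\<in>D k. dist S' S < e" if S: "S \<in> M" "S \<noteq> 0" and e: "e > 0" for S e
    proof -
      define N where "N = norm S"
      have N: "N > 0" using S by (simp add: N_def)
      obtain d where d: "d > 0" "\<And>z v. z \<in> U \<Longrightarrow> norm v \<le> 1 \<Longrightarrow> cmod (\<Phi> z v) > 1 - d \<Longrightarrow>
          \<exists>l. cmod l = 1 \<and> norm (P v - l *\<^sub>C z) < (1/2) ^ k"
        using exposed[of "(1/2) ^ k"] by auto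
      define \<epsilon> where "\<epsilon> = min 1 (e / (2 * N))"
      have \<epsilon>: "\<epsilon> > 0" "\<epsilon> \<le> 1" "\<epsilon> * N \<le> e / 2"
        using e N by (auto simp: \<epsilon>_def min_def field_simps)
      define h where "h = \<epsilon> * N * d / 4"
      have h: "h > 0" using \<epsilon> N d by (simp add: h_def)
      obtain z where z: "z \<in> U" "norm (S z) > N - h"
        using norming[OF MD(1)[OF S(1)] MD(2)[OF S(1)] h] by (auto simp: N_def)
      note \<Phi>z = \<Phi>[OF z(1)]
      have "bounded_linear (\<lambda>v. S v + \<epsilon> *\<^sub>R (\<Phi> z v *\<^sub>C S z))"
        using \<Phi>z(1)
        by (intro bounded_linear_add blinfun.bounded_linear_right bounded_linear_const_scaleR
            bounded_linear_rank_one)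
      moreover have "S (c *\<^sub>C v) + \<epsilon> *\<^sub>R (\<Phi> z (c *\<^sub>C v) *\<^sub>C S z) =
          c *\<^sub>C (S v + \<epsilon> *\<^sub>R (\<Phi> z v *\<^sub>C S z))" for c v
        by (simp add: clinopsD[OF MD(1)[OF S(1)]] clinear_functionalD(2)[OF \<Phi>z(1)] scaleC_add_right
            scaleC_scaleC scaleR_scaleC mult.left_commute)
      ultimately obtain S' where S': "S' \<in> clinops"
        "blinfun_apply S' = (\<lambda>v. S v + \<epsilon> *\<^sub>R (\<Phi> z v *\<^sub>C S z))"
        by (rule obtain_clinop)
      have Sz: "norm (S z) \<le> N" using U(1)[OF z(1)] norm_blinfun_le by (auto simp: N_def)
      have "norm (S' - S) \<le> e / 2"
      proof (rule norm_blinfun_boundI)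
        fix v :: 'z assume "norm v \<le> 1"
        then have "cmod (\<Phi> z v) \<le> 1" using \<Phi>z(2)[of v] by simp
        then have "cmod (\<Phi> z v) * norm (S z) \<le> 1 * N" using Sz by (intro mult_mono) auto
        then have "\<epsilon> * (cmod (\<Phi> z v) * norm (S z)) \<le> \<epsilon> * N" using \<epsilon>(1) by simp
        moreover have "norm ((S' - S) v) = \<epsilon> * (cmod (\<Phi> z v) * norm (S z))"
          using \<epsilon>(1) by (simp add: blinfun.diff_left S'(2) norm_scaleC)
        ultimately show "norm ((S' - S) v) \<le> e / 2" using \<epsilon>(3) by simp
      qed
      then have "dist S' S < e" using e by (simp add: dist_norm)
      moreover have "S' \<in> M"
        using S' MD(2)[OF S(1)] \<Phi>z(4) by (simp add: M_def)
      moreover have "conf S' ((1/2) ^ k) z (2 * h)"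
        unfolding conf_def
      proof (intro allI impI)
        fix v assume v: "norm v \<le> 1" "norm S' - 2 * h < norm (S' v)"
        have "S' z = (1 + \<epsilon>) *\<^sub>R S z" by (simp add: S'(2) \<Phi>z(3) scaleR_add_left)
        then have "(1 + \<epsilon>) * norm (S z) \<le> norm S'"
          using norm_blinfun_le[of z S'] U(1)[OF z(1)] \<epsilon>(1) by simp
        moreover have "(1 + \<epsilon>) * (N - h) < (1 + \<epsilon>) * norm (S z)" using z(2) \<epsilon>(1) by simp
        moreover have "\<epsilon> * h \<le> h" using \<epsilon>(2) h by simp
        moreover have "norm (S' v) \<le> N + \<epsilon> * (cmod (\<Phi> z v) * N)"
        proof -
          have "norm (S' v) \<le> norm (S v) + \<epsilon> * (cmod (\<Phi> z v) * norm (S z))"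
            using norm_triangle_ineq[of "S v" "\<epsilon> *\<^sub>R (\<Phi> z v *\<^sub>C S z)"] \<epsilon>(1)
            by (simp add: S'(2) norm_scaleC)
          also have "\<dots> \<le> N + \<epsilon> * (cmod (\<Phi> z v) * N)"
            using norm_blinfun_le[OF v(1), of S] \<epsilon>(1) Sz
            by (intro add_mono mult_left_mono) (auto simp: N_def)
          finally show ?thesis .
        qed
        ultimately have "(\<epsilon> * N) * (1 - d) < (\<epsilon> * N) * cmod (\<Phi> z v)"
        proof -
          assume a: "(1 + \<epsilon>) * norm (S z) \<le> norm S'" "(1 + \<epsilon>) * (N - h) < (1 + \<epsilon>) * norm (S z)"
            "\<epsilon> * h \<le> h" "norm (S' v) \<le> N + \<epsilon> * (cmod (\<Phi> z v) * N)"
          have "(1 + \<epsilon>) * (N - h) = N + \<epsilon> * N - h - \<epsilon> * h" "\<epsilon> * N * d = 4 * h"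
            "(\<epsilon> * N) * (1 - d) = \<epsilon> * N - \<epsilon> * N * d"
            "(\<epsilon> * N) * cmod (\<Phi> z v) = \<epsilon> * (cmod (\<Phi> z v) * N)"
            by (simp_all add: h_def algebra_simps)
          with a v(2) show ?thesis by linarith
        qed
        then have "cmod (\<Phi> z v) > 1 - d" using \<epsilon>(1) N by simp
        then show "\<exists>l. cmod l = 1 \<and> norm (P v - l *\<^sub>C z) < (1/2) ^ k" using d(2) z(1) v(1) by blast
      qed
      moreover have "2 * h > 0" using h by simp
      ultimately show ?thesis unfolding D_def using z(1) by blast
    qed
    show ?thesis
    proof (cases "S = 0")
      case True
      define t where "t = e / (4 * norm T)"
      have t: "t > 0" "t * norm T = e / 4" using T(3) \<open>e > 0\<close> by (auto simp: t_def)
      have "t *\<^sub>R T \<in> M"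
        using T(1,2) by (auto simp: M_def clinops_def blinfun.scaleR_left scaleR_scaleC scaleC_scaleC mult.commute)
      then obtain S' where "S' \<in> D k" "dist S' (t *\<^sub>R T) < e / 2"
        using step[of "t *\<^sub>R T" "e / 2"] t T(3) \<open>e > 0\<close> by auto
      moreover have "dist (t *\<^sub>R T) S = e / 4" using t True by (simp add: dist_norm)
      ultimately show ?thesis
        using dist_triangle[of S' S "t *\<^sub>R T"] \<open>e > 0\<close> by (intro bexI[of _ S']) auto
    qed (use step that in blast)
  qed
  moreover have "T \<in> M" using T by (simp add: M_def)
  ultimately obtain S where S: "S \<in> M" "\<And>k. S \<in> D k" "dist S T < \<kappa>"
    using Baire_closed_subset[OF \<open>closed M\<close>, of D T \<kappa>] \<kappa> by blast
  then have "\<forall>k. \<exists>z \<xi>. z \<in> U \<and> \<xi> > 0 \<and> conf S ((1/2) ^ k) z \<xi>"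
    unfolding D_def by blast
  then obtain \<zeta> \<xi> where \<zeta>: "\<And>k. \<zeta> k \<in> U" "\<And>k. \<xi> k > 0" "\<And>k. conf S ((1/2) ^ k) (\<zeta> k) (\<xi> k)"
    by metis

  \<comment> \<open>two points confined by the same \<open>\<zeta> k\<close> are close up to a rotation\<close>
  have near: "\<exists>l. cmod l = 1 \<and> norm (P v - l *\<^sub>C P x) < 2 * (1/2) ^ k"
    if v: "norm v \<le> 1" "norm (S v) > norm S - \<xi> k" and x: "norm x \<le> 1" "norm (S x) > norm S - \<xi> k"
    for v x k
  proof -
    obtain l where l: "cmod l = 1" "norm (P v - l *\<^sub>C \<zeta> k) < (1/2) ^ k"
      using \<zeta>(3)[of k] v unfolding conf_def by blast
    obtain m where m: "cmod m = 1" "norm (P x - m *\<^sub>C \<zeta> k) < (1/2) ^ k"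
      using \<zeta>(3)[of k] x unfolding conf_def by blast
    define a where "a = l * inverse m"
    have a: "cmod a = 1" using l(1) m(1) by (simp add: a_def norm_mult norm_inverse)
    have "a *\<^sub>C (P x - m *\<^sub>C \<zeta> k) = a *\<^sub>C P x - l *\<^sub>C \<zeta> k"
      using inverse_rotation(2)[OF m(1)]
      by (simp add: complex_vector.scale_right_diff_distrib a_def scaleC_scaleC mult.assoc)
    then have "norm (a *\<^sub>C P x - l *\<^sub>C \<zeta> k) < (1/2) ^ k" using m(2) a by (metis mult_1 norm_scaleC)
    with l(2) have "norm (P v - a *\<^sub>C P x) < 2 * (1/2) ^ k"
      using norm_triangle_ineq4[of "P v - l *\<^sub>C \<zeta> k" "a *\<^sub>C P x - l *\<^sub>C \<zeta> k"] by simp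
    with a show ?thesis by blast
  qed
  define good where "good k x \<longleftrightarrow> x \<in> U \<and> norm (S x) > norm S - \<xi> k \<and> norm (S x) > norm S - (1/2) ^ k"
    for k x
  have ex: "\<exists>x. x \<in> U \<and> norm (S x) > norm S - c" if "c > 0" for c
    using norming[OF MD(1)[OF S(1)] MD(2)[OF S(1)] that] by blast
  have "\<exists>x. \<forall>n. good n (x n) \<and> dist (x n) (x (Suc n)) < 2 * (1/2) ^ n"
  proof (rule dependent_nat_choice)
    show "\<exists>x. good 0 x"
      using ex[of "min (\<xi> 0) 1"] \<zeta>(2)[of 0] by (auto simp: good_def)
    fix x n assume x: "good n x"
    obtain v where v: "v \<in> U" "norm (S v) > norm S - Min {\<xi> n, \<xi> (Suc n), (1/2) ^ Suc n}"
      using ex[of "Min {\<xi> n, \<xi> (Suc n), (1/2) ^ Suc n}"] \<zeta>(2) by auto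
    have v': "norm (S v) > norm S - \<xi> n" "norm (S v) > norm S - \<xi> (Suc n)"
      "norm (S v) > norm S - (1/2) ^ Suc n" using v(2) by auto
    obtain l where l: "cmod l = 1" "norm (x - l *\<^sub>C v) < 2 * (1/2) ^ n"
      using near[of x n v] x v' U(1) v(1) by (auto simp: good_def)
    have "good (Suc n) (l *\<^sub>C v)"
      using v(1) v' l(1) U(3) by (simp add: good_def clinopsD[OF MD(1)[OF S(1)]] norm_scaleC)
    with l(2) show "\<exists>y. good (Suc n) y \<and> dist x y < 2 * (1/2) ^ n" by (auto simp: dist_norm)
  qed
  then obtain x where x: "\<And>n. good n (x n)" "\<And>n. dist (x n) (x (Suc n)) < 2 * (1/2) ^ n" by blast
  have "summable (\<lambda>n. x (Suc n) - x n)"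
  proof (rule summable_comparison_test)
    show "summable (\<lambda>n. 2 * (1/2) ^ n :: real)" by (intro summable_mult summable_geometric) simp
    show "\<exists>N. \<forall>n\<ge>N. norm (x (Suc n) - x n) \<le> 2 * (1/2) ^ n"
      using x(2) by (auto simp: dist_norm norm_minus_commute less_imp_le)
  qed
  from summable_LIMSEQ[OF this] obtain s where "(\<lambda>n. x n - x 0) \<longlonglongrightarrow> s"
    by (auto simp: sum_lessThan_telescope)
  from tendsto_add[OF this tendsto_const[of "x 0"]] obtain z where z: "x \<longlonglongrightarrow> z" by auto
  have zU: "z \<in> U" using closed_sequentially[OF U(2) _ z] x(1) by (auto simp: good_def)
  have Sz: "norm (S z) = norm S"
  proof (rule LIMSEQ_unique)
    show "(\<lambda>n. norm (S (x n))) \<longlonglongrightarrow> norm (S z)" by (intro tendsto_intros z)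
    show "(\<lambda>n. norm (S (x n))) \<longlonglongrightarrow> norm S"
    proof (rule real_tendsto_sandwich[OF always_eventually always_eventually _ tendsto_const])
      show "(\<lambda>n. norm S - (1/2) ^ n) \<longlonglongrightarrow> norm S"
        using tendsto_diff[OF tendsto_const LIMSEQ_power_zero[of "1/2 :: real"]] by simp
      show "\<forall>n. norm S - (1/2) ^ n \<le> norm (S (x n))"
        using x(1) by (auto simp: good_def less_imp_le)
      show "\<forall>n. norm (S (x n)) \<le> norm S"
        using x(1) U(1) norm_blinfun_le by (auto simp: good_def)
    qed
  qed
  have "exposes_range_at S z"
    unfolding exposes_range_at_def
  proof (intro allI impI, elim conjE)
    fix v :: "nat \<Rightarrow> 'z"
    assume v: "\<forall>n. norm (v n) \<le> 1" "(\<lambda>n. norm (S (v n))) \<longlonglongrightarrow> norm S"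
    have "\<exists>l. cmod l = 1 \<and> (\<forall>m. cmod m = 1 \<longrightarrow> norm (P (v n) - l *\<^sub>C z) \<le> norm (P (v n) - m *\<^sub>C z))" for n
    proof -
      have "continuous_on (sphere 0 1) (\<lambda>l. norm (P (v n) - l *\<^sub>C z))"
        by (intro continuous_intros linear_continuous_on bounded_linear_scaleC_left)
      then obtain l where "l \<in> sphere 0 1"
        "\<forall>m\<in>sphere 0 1. norm (P (v n) - l *\<^sub>C z) \<le> norm (P (v n) - m *\<^sub>C z)"
        using continuous_attains_inf[of "sphere (0 :: complex) 1" "\<lambda>l. norm (P (v n) - l *\<^sub>C z)"]
        by auto
      then show ?thesis by auto
    qed
    then obtain l where l: "\<And>n. cmod (l n) = 1"
      "\<And>n m. cmod m = 1 \<Longrightarrow> norm (P (v n) - l n *\<^sub>C z) \<le> norm (P (v n) - m *\<^sub>C z)" by metis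
    have "(\<lambda>n. P (v n) - l n *\<^sub>C z) \<longlonglongrightarrow> 0"
    proof (rule LIMSEQ_I)
      fix e :: real assume "e > 0"
      then obtain k where k: "2 * (1/2 :: real) ^ k < e"
        using real_arch_pow_inv[of "e / 2" "1/2"] by (auto simp: field_simps)
      have "eventually (\<lambda>n. norm (S (v n)) > norm S - \<xi> k) sequentially"
        using v(2) \<zeta>(2)[of k] by (intro order_tendstoD) auto
      then obtain N where N: "\<And>n. n \<ge> N \<Longrightarrow> norm (S (v n)) > norm S - \<xi> k"
        by (auto simp: eventually_sequentially)
      have "norm (P (v n) - l n *\<^sub>C z - 0) < e" if n: "n \<ge> N" for n
      proof -
        obtain m where "cmod m = 1" "norm (P (v n) - m *\<^sub>C P z) < 2 * (1/2) ^ k"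
          using near[of "v n" k z] v(1) N[OF n] U(1)[OF zU] Sz \<zeta>(2)[of k] by auto
        with l(2)[of m n] k U(1)[OF zU] show ?thesis by simp
      qed
      then show "\<exists>N. \<forall>n\<ge>N. norm (P (v n) - l n *\<^sub>C z - 0) < e" by blast
    qed
    moreover have "\<exists>a\<in>sphere 0 1. \<exists>\<sigma> :: nat \<Rightarrow> nat. strict_mono \<sigma> \<and> (l \<circ> \<sigma>) \<longlonglongrightarrow> a"
      using compact_imp_seq_compact[OF compact_sphere[of "0::complex" 1]] l(1)
      unfolding seq_compact_def by simp
    then obtain a \<sigma> where a: "cmod a = 1" "strict_mono (\<sigma> :: nat \<Rightarrow> nat)" "(l \<circ> \<sigma>) \<longlonglongrightarrow> a" by auto
    ultimately have "(\<lambda>n. P (v (\<sigma> n)) - l (\<sigma> n) *\<^sub>C z) \<longlonglongrightarrow> 0"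
      using LIMSEQ_subseq_LIMSEQ[of _ 0 \<sigma>] by (simp add: o_def)
    moreover have "(\<lambda>n. l (\<sigma> n) *\<^sub>C z) \<longlonglongrightarrow> a *\<^sub>C z"
      using a(3) bounded_linear.tendsto[OF bounded_linear_scaleC_left] by (simp add: o_def)
    ultimately have "(\<lambda>n. (P (v (\<sigma> n)) - l (\<sigma> n) *\<^sub>C z) + l (\<sigma> n) *\<^sub>C z) \<longlonglongrightarrow> 0 + a *\<^sub>C z"
      by (rule tendsto_add)
    then have "(\<lambda>n. S (P (v (\<sigma> n)))) \<longlonglongrightarrow> S (a *\<^sub>C z)"
      by (intro tendsto_intros) simp
    then show "\<exists>\<sigma> l. strict_mono \<sigma> \<and> cmod l = 1 \<and> (\<lambda>n. S (v (\<sigma> n))) \<longlonglongrightarrow> l *\<^sub>C S z"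
      using a MD[OF S(1)] by (auto simp: clinopsD)
  qed
  then show thesis
    using that[of S z] MD[OF S(1)] S(3) zU Sz by (simp add: dist_norm)
qed

section \<open>Spaces of null families with the supremum norm\<close>

lemma complex_midpoint_of_units:
  assumes "cmod a \<le> 1"
  obtains b c where "cmod b = 1" "cmod c = 1" "b + c = 2 * a"
proof -
  obtain w where w: "cmod w = 1" "w * a = cmod a" using exists_unit_rotation by blast
  define s where "s = sqrt (1 - (cmod a)\<^sup>2)"
  have s: "s\<^sup>2 = 1 - (cmod a)\<^sup>2" using assms by (simp add: s_def power_le_one)
  show thesis
  proof (rule that)
    show "cmod (inverse w * Complex (cmod a) s) = 1" "cmod (inverse w * Complex (cmod a) (- s)) = 1"
      using s w(1) by (simp_all add: norm_mult norm_inverse, simp_all add: cmod_def)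
    have "Complex (cmod a) s + Complex (cmod a) (- s) = 2 * (w * a)"
      by (simp add: complex_eq_iff w(2))
    moreover have "inverse w * (w * a) = a" using inverse_rotation(2)[OF w(1)] by (metis mult.assoc mult_1)
    ultimately show "inverse w * Complex (cmod a) s + inverse w * Complex (cmod a) (- s) = 2 * a"
      by (metis distrib_left mult.left_commute)
  qed
qed

text \<open>The axioms describe \<open>c\<^sub>0(I, X)\<close> for an index set \<open>I\<close> of any size. Every argument below
  concerns finitely many coordinates, so \<open>c\<^sub>0(X)\<close> and \<open>\<ell>\<^sub>\<infinity>\<^sup>m(X)\<close> are treated together.\<close>

locale coordinate_space =
  fixes nth :: "'z::complex_banach \<Rightarrow> 'i \<Rightarrow> 'x::complex_banach" and inj :: "'i \<Rightarrow> 'x \<Rightarrow> 'z"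
  assumes nth_add: "nth (u + v) i = nth u i + nth v i"
    and nth_scaleC: "nth (c *\<^sub>C v) i = c *\<^sub>C nth v i"
    and nth_inj: "nth (inj i a) j = (if j = i then a else 0)"
    and norm_nth_le: "norm (nth v i) \<le> norm v"
    and norm_le: "(\<And>i. norm (nth v i) \<le> b) \<Longrightarrow> norm v \<le> b"
    and finite_large: "e > 0 \<Longrightarrow> finite {i. norm (nth v i) \<ge> e}"
begin

lemma nth_scaleR: "nth (r *\<^sub>R v) i = r *\<^sub>R nth v i"
  by (simp add: scaleR_scaleC nth_scaleC)

lemma bounded_linear_nth: "bounded_linear (\<lambda>v. nth v i)"
  by (rule bounded_linear_intro[of _ 1]) (auto simp: nth_add nth_scaleR norm_nth_le)

lemma nth_diff: "nth (u - v) i = nth u i - nth v i"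
  by (rule linear_diff[OF bounded_linear.linear[OF bounded_linear_nth]])

lemma nth_zero: "nth 0 i = 0"
  using nth_diff[of 0 0] by simp

lemma nth_minus: "nth (- v) i = - nth v i"
  using nth_diff[of 0 v] by (simp add: nth_zero)

lemma nth_sum: "nth (sum f J) i = (\<Sum>j\<in>J. nth (f j) i)"
  by (induction J rule: infinite_finite_induct) (auto simp: nth_zero nth_add)

lemmas nth_simps = nth_add nth_diff nth_minus nth_zero nth_scaleC nth_scaleR nth_inj

lemma coordinates_eqI:
  assumes "\<And>i. nth u i = nth v i"
  shows "u = v"
  using norm_le[of "u - v" 0] assms by (simp add: nth_diff)

lemma inj_add: "inj i (a + b) = inj i a + inj i b"
  and inj_scaleC: "inj i (c *\<^sub>C a) = c *\<^sub>C inj i a"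
  by (rule coordinates_eqI; simp add: nth_simps)+

lemma bounded_linear_inj: "bounded_linear (inj i)"
proof (rule bounded_linear_intro[of _ 1])
  show "norm (inj i a) \<le> norm a * 1" for a by (rule norm_le) (simp add: nth_inj)
qed (auto simp: inj_add inj_scaleC scaleR_scaleC)

definition proj :: "'i set \<Rightarrow> 'z \<Rightarrow> 'z" where
  "proj J v = (\<Sum>i\<in>J. inj i (nth v i))"

lemma nth_proj: "finite J \<Longrightarrow> nth (proj J v) i = (if i \<in> J then nth v i else 0)"
  by (simp add: proj_def nth_sum nth_inj)

lemma norm_proj_le: "finite J \<Longrightarrow> norm (proj J v) \<le> norm v"
  by (rule norm_le) (simp add: nth_proj norm_nth_le)

lemma proj_scaleC: "finite J \<Longrightarrow> proj J (c *\<^sub>C v) = c *\<^sub>C proj J v"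
  by (rule coordinates_eqI) (simp add: nth_proj nth_simps)

lemma proj_diff: "finite J \<Longrightarrow> proj J (u - v) = proj J u - proj J v"
  by (rule coordinates_eqI) (simp add: nth_proj nth_simps)

lemma proj_proj: "finite J \<Longrightarrow> finite K \<Longrightarrow> proj J (proj K v) = proj (J \<inter> K) v"
  by (rule coordinates_eqI) (simp add: nth_proj)

lemma bounded_linear_proj: "finite J \<Longrightarrow> bounded_linear (proj J)"
proof (rule bounded_linear_intro[of _ 1])
  assume "finite J"
  then show "proj J (u + v) = proj J u + proj J v" "proj J (r *\<^sub>R v) = r *\<^sub>R proj J v"
    "norm (proj J v) \<le> norm v * 1" for u v r
    by (auto intro!: coordinates_eqI simp: nth_proj nth_simps norm_proj_le)
qed

lemma proj_approx:
  assumes "e > 0"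
  obtains J where "finite J" "norm (v - proj J v) \<le> e"
proof (rule that)
  show fin: "finite {i. norm (nth v i) \<ge> e}" by (rule finite_large[OF assms])
  show "norm (v - proj {i. norm (nth v i) \<ge> e} v) \<le> e"
    using assms by (intro norm_le) (auto simp: nth_diff nth_proj[OF fin])
qed

subsection \<open>The mass of a functional\<close>

lemma clinear_functional_inj:
  assumes "clinear_functional F"
  shows "clinear_functional (\<lambda>a. F (inj i a))"
  using bounded_linear_compose[OF clinear_functionalD(1)[OF assms] bounded_linear_inj]
    clinear_functionalD(2)[OF assms]
  by (simp add: clinear_functional_def inj_scaleC)

text \<open>The dual space is the \<open>\<ell>\<^sub>1\<close>-sum of copies of the dual of \<open>X\<close>; the mass at \<open>i\<close> is the dual
  norm of the \<open>i\<close>-th component of \<open>F\<close>, so the masses of a contractive \<open>F\<close> sum to at most \<open>1\<close>.\<close>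

definition mass :: "('z \<Rightarrow> complex) \<Rightarrow> 'i \<Rightarrow> real" where
  "mass F i = onorm (\<lambda>a. F (inj i a))"

context
  fixes F :: "'z \<Rightarrow> complex"
  assumes F: "clinear_functional F" "\<And>v. cmod (F v) \<le> norm v"
begin

lemma mass_bound: "cmod (F (inj i a)) \<le> mass F i * norm a"
  unfolding mass_def by (rule onorm[OF clinear_functionalD(1)[OF clinear_functional_inj[OF F(1)]]])

lemma mass_nonneg: "0 \<le> mass F i"
  unfolding mass_def by (rule onorm_pos_le[OF clinear_functionalD(1)[OF clinear_functional_inj[OF F(1)]]])

lemma mass_bound_Re:
  assumes "norm a \<le> 1"
  shows "Re (F (inj i a)) \<le> mass F i"
  using complex_Re_le_cmod[of "F (inj i a)"] mass_bound[of i a]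
    mult_left_mono[OF assms mass_nonneg[of i]] by linarith

lemma mass_nearly_attained:
  assumes "e > 0"
  shows "\<exists>a. norm a \<le> 1 \<and> Re (F (inj i a)) > mass F i - e"
proof (rule ccontr)
  assume neg: "\<not> ?thesis"
  have le: "cmod (F (inj i a)) \<le> mass F i - e" if "norm a \<le> 1" for a
  proof -
    obtain w where w: "cmod w = 1" "w * F (inj i a) = cmod (F (inj i a))"
      using exists_unit_rotation by blast
    have "Re (F (inj i (w *\<^sub>C a))) = cmod (F (inj i a))"
      using w(2) clinear_functionalD(2)[OF F(1)] by (simp add: inj_scaleC)
    moreover have "norm (w *\<^sub>C a) \<le> 1" using that w(1) by (simp add: norm_scaleC)
    ultimately show ?thesis using neg by (metis not_less)
  qed
  have "mass F i \<le> mass F i - e"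
    unfolding mass_def
  proof (rule onorm_bound)
    show "0 \<le> onorm (\<lambda>a. F (inj i a)) - e"
      using order_trans[OF norm_ge_zero le[of 0]] by (simp add: mass_def)
    show "cmod (F (inj i a)) \<le> (onorm (\<lambda>a. F (inj i a)) - e) * norm a" for a
    proof (cases "a = 0")
      case False
      have "F (inj i (sgn a)) = F (inj i a) / norm a"
        using False clinear_functionalD(7)[OF clinear_functional_inj[OF F(1)], where r = "inverse (norm a)"]
        by (simp add: sgn_div_norm divide_inverse_commute scaleR_conv_of_real)
      then have "cmod (F (inj i a)) / norm a \<le> mass F i - e"
        using le[of "sgn a"] False by (simp add: norm_sgn norm_divide)
      then show ?thesis using False by (simp add: divide_le_eq mass_def)
    qed (simp add: clinear_functionalD(6)[OF clinear_functional_inj[OF F(1)]])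
  qed
  with assms show False by simp
qed

lemma functional_proj: "F (proj J v) = (\<Sum>i\<in>J. F (inj i (nth v i)))"
  unfolding proj_def by (rule linear_sum[OF bounded_linear.linear[OF clinear_functionalD(1)[OF F(1)]]])

lemma mass_sum_le_one:
  assumes "finite J"
  shows "(\<Sum>i\<in>J. mass F i) \<le> 1"
proof (rule field_le_epsilon)
  fix e :: real assume "e > 0"
  define h where "h = e / (card J + 1)"
  have h: "h > 0" "card J * h \<le> e" using \<open>e > 0\<close> by (auto simp: h_def field_simps)
  obtain a where a: "\<And>i. norm (a i) \<le> 1" "\<And>i. Re (F (inj i (a i))) > mass F i - h"
    using mass_nearly_attained[OF h(1)] by metis
  define v where "v = (\<Sum>i\<in>J. inj i (a i))"
  have "(\<Sum>i\<in>J. mass F i) - card J * h = (\<Sum>i\<in>J. mass F i - h)" by (simp add: sum_subtractf)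
  also have "\<dots> \<le> (\<Sum>i\<in>J. Re (F (inj i (a i))))" using a(2) by (intro sum_mono less_imp_le)
  also have "\<dots> = Re (F v)"
    unfolding v_def
    by (simp add: linear_sum[OF bounded_linear.linear[OF clinear_functionalD(1)[OF F(1)]]])
  also have "\<dots> \<le> 1"
  proof -
    have "norm v \<le> 1"
      using assms a(1) by (intro norm_le) (simp add: v_def nth_sum nth_inj)
    then show ?thesis using F(2)[of v] complex_Re_le_cmod[of "F v"] by linarith
  qed
  finally show "(\<Sum>i\<in>J. mass F i) \<le> 1 + e" using h(2) by simp
qed

text \<open>A point at which \<open>F\<close> is nearly \<open>1\<close> must nearly norm the restriction of \<open>F\<close> to every
  coordinate, except for coordinates of small total mass; discarding these costs little.\<close>

lemma nearly_norming_coordinates: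
  assumes J: "finite J" and v: "norm v \<le> 1" "Re (F (proj J v)) > 1 - h" and g: "0 < g" "g \<le> 1"
  defines "B \<equiv> {i \<in> J. Re (F (inj i (nth v i))) > (1 - g) * mass F i}"
  shows "Re (F (proj B v)) > 1 - 2 * h / g"
proof -
  let ?r = "\<lambda>i. Re (F (inj i (nth v i)))"
  have r: "?r i \<le> mass F i" for i
    by (rule mass_bound_Re) (rule order_trans[OF norm_nth_le v(1)])
  have split: "sum f J = sum f B + sum f (J - B)" for f :: "'i \<Rightarrow> real"
    using sum.subset_diff[of B J f] J by (auto simp: B_def)
  have "sum ?r (J - B) \<le> (\<Sum>i\<in>J - B. (1 - g) * mass F i)"
    by (rule sum_mono) (auto simp: B_def not_less)
  also have "\<dots> = (1 - g) * sum (mass F) (J - B)" by (simp add: sum_distrib_left)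
  finally have JB: "sum ?r (J - B) \<le> (1 - g) * sum (mass F) (J - B)" .
  have "sum ?r B \<le> sum (mass F) B" by (rule sum_mono) (rule r)
  moreover have J1: "1 - h < sum ?r J" using v(2) by (simp add: functional_proj)
  moreover have "sum (mass F) J \<le> 1" by (rule mass_sum_le_one[OF J])
  ultimately have "1 - h < 1 - g * sum (mass F) (J - B)"
    using JB split[of ?r] split[of "mass F"] by (simp add: algebra_simps)
  then have m: "sum (mass F) (J - B) < h / g" using g(1) by (simp add: field_simps)
  have m0: "0 \<le> sum (mass F) (J - B)" by (intro sum_nonneg mass_nonneg)
  then have "h / g > 0" using m by linarith
  then have h: "h > 0" using g(1) by (simp add: zero_less_divide_iff)
  have "(1 - g) * sum (mass F) (J - B) \<le> sum (mass F) (J - B)"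
    using m0 g(1) by (simp add: algebra_simps)
  then have "sum ?r B > 1 - h - h / g" using JB J1 m split[of ?r] by linarith
  moreover have "h \<le> h / g" using h g by (simp add: field_simps)
  moreover have "2 * h / g = h / g + h / g" by simp
  ultimately show ?thesis by (simp add: functional_proj)
qed

end

subsection \<open>Operators that depend on finitely many coordinates\<close>

lemma midpoint_of_unit_vectors:
  fixes a :: 'x
  assumes "norm a \<le> 1" "(e :: 'x) \<noteq> 0"
  obtains b c where "norm b = 1" "norm c = 1" "b + c = 2 *\<^sub>R a"
proof -
  obtain u where u: "norm u = 1" "norm a *\<^sub>R u = a"
    using assms(2) by (cases "a = 0") (auto simp: norm_sgn sgn_div_norm intro: that[of "sgn e"] that[of "sgn a"])
  obtain b c where bc: "cmod b = 1" "cmod c = 1" "b + c = 2 * complex_of_real (norm a)"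
    using complex_midpoint_of_units[of "complex_of_real (norm a)"] assms(1) by auto
  have "b *\<^sub>C u + c *\<^sub>C u = complex_of_real (2 * norm a) *\<^sub>C u"
    using bc(3) by (simp add: scaleC_add_left[symmetric])
  also have "\<dots> = 2 *\<^sub>R a" using u(2) by (metis scaleR_scaleC scaleR_scaleR)
  finally show thesis using bc u(1) by (intro that[of "b *\<^sub>C u" "c *\<^sub>C u"]) (auto simp: norm_scaleC)
qed

lemma increase_to_unit_coordinates:
  assumes "finite B" and v: "norm v \<le> 1" and e: "(e :: 'x) \<noteq> 0"
  shows "\<exists>w. norm w \<le> 1 \<and> (\<forall>i\<in>B. norm (nth w i) = 1) \<and>
    norm (blinfun_apply T v) \<le> norm (blinfun_apply T w)"
  using assms(1)
proof (induction B rule: finite_induct)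
  case empty
  then show ?case using v by auto
next
  case (insert i B)
  then obtain w where w: "norm w \<le> 1" "\<And>j. j \<in> B \<Longrightarrow> norm (nth w j) = 1" "norm (T v) \<le> norm (T w)"
    by blast
  obtain b c where bc: "norm b = 1" "norm c = 1" "b + c = 2 *\<^sub>R nth w i"
    using midpoint_of_unit_vectors[OF order_trans[OF norm_nth_le w(1)] e] by blast
  define u where "u a = w + inj i (a - nth w i)" for a
  have nth_u: "nth (u a) j = (if j = i then a else nth w j)" for a j
    by (simp add: u_def nth_simps)
  have ok: "norm (u a) \<le> 1 \<and> (\<forall>j\<in>insert i B. norm (nth (u a) j) = 1)" if "norm a = 1" for a
    using that w(2) order_trans[OF norm_nth_le w(1)] by (auto simp: nth_u intro!: norm_le)
  have "u b + u c = 2 *\<^sub>R w"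
    using bc(3) by (intro coordinates_eqI) (simp add: nth_simps nth_u scaleR_2)
  then have "2 * norm (T w) = norm (T (u b) + T (u c))"
    by (simp add: blinfun.add_right[symmetric] blinfun.scaleR_right)
  also have "\<dots> \<le> norm (T (u b)) + norm (T (u c))" by (rule norm_triangle_ineq)
  finally have "norm (T v) \<le> norm (T (u b)) \<or> norm (T v) \<le> norm (T (u c))" using w(3) by linarith
  with ok bc show ?case by blast
qed

text \<open>For uniformly convex \<open>X\<close>, the average of norming functionals of the coordinates in \<open>B\<close>
  exposes the points whose coordinates in \<open>B\<close> have norm \<open>1\<close>, uniformly in these points. Since
  every vector of the ball is an average of two unit vectors, the supremum over such points is the
  norm of any operator that depends only on the coordinates in \<open>B\<close>.\<close>

lemma exposes_range_dense_on_coordinates: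
  fixes T :: "'z \<Rightarrow>\<^sub>L 'y::complex_banach"
  assumes uc: "uniformly_convex TYPE('x)" and B: "finite B" "B \<noteq> {}" and e: "(e :: 'x) \<noteq> 0"
    and T: "T \<in> clinops" "\<And>v. T (proj B v) = T v" "T \<noteq> 0" and \<kappa>: "\<kappa> > 0"
  obtains S z where "S \<in> clinops" "\<And>v. S (proj B v) = S v" "norm (S - T) < \<kappa>"
    "proj B z = z" "\<And>i. i \<in> B \<Longrightarrow> norm (nth z i) = 1" "norm (S z) = norm S" "exposes_range_at S z"
proof -
  define U where "U = {z. proj B z = z \<and> (\<forall>i\<in>B. norm (nth z i) = 1)}"
  define N where "N = real (card B)"
  have N: "N > 0" using B by (simp add: N_def card_gt_0_iff)
  obtain f where f: "\<And>a :: 'x. clinear_functional (f a)" "\<And>a v. cmod (f a v) \<le> norm v"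
    "\<And>a. f a a = norm a"
    using norming_functional by metis
  note fD = clinear_functionalD[OF f(1)]
  define \<Phi> where "\<Phi> z v = (\<Sum>i\<in>B. f (nth z i) (nth v i)) / N" for z v
  have U_ball: "norm z \<le> 1" if "z \<in> U" for z
  proof (rule norm_le)
    fix i
    have "nth z i = (if i \<in> B then nth z i else 0)"
      using that nth_proj[OF B(1), of z i] by (simp add: U_def)
    with that show "norm (nth z i) \<le> 1" by (auto simp: U_def split: if_splits)
  qed
  have "U = {z. proj B z = z} \<inter> (\<Inter>i\<in>B. {z. norm (nth z i) = 1})" by (auto simp: U_def)
  moreover have "closed {z. norm (nth z i) = 1}" for i
    by (rule closed_Collect_eq[OF continuous_on_norm[OF linear_continuous_on[OF bounded_linear_nth]]
          continuous_on_const])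
  moreover have "closed {z. proj B z = z}"
    by (rule closed_Collect_eq[OF linear_continuous_on[OF bounded_linear_proj[OF B(1)]]
          continuous_on_id])
  ultimately have "closed U" by auto
  have \<Phi>_bound: "cmod (\<Phi> z v) \<le> norm v" for z v
  proof -
    have "cmod (\<Sum>i\<in>B. f (nth z i) (nth v i)) \<le> (\<Sum>i\<in>B. norm v)"
      using f(2) norm_nth_le by (intro order_trans[OF norm_sum] sum_mono) (meson order_trans)
    then show ?thesis using N by (simp add: \<Phi>_def norm_divide field_simps N_def)
  qed
  have \<Phi>_lin: "\<Phi> z (u + v) = \<Phi> z u + \<Phi> z v" "\<Phi> z (c *\<^sub>C v) = c * \<Phi> z v" for z u v c
    by (simp_all add: \<Phi>_def nth_simps fD sum.distrib add_divide_distrib sum_distrib_left)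
  have \<Phi>: "clinear_functional (\<Phi> z)" for z
    unfolding clinear_functional_def
  proof (intro conjI allI \<Phi>_lin(2))
    have "\<Phi> z (r *\<^sub>R v) = r *\<^sub>R \<Phi> z v" for r v
      by (simp add: scaleR_scaleC \<Phi>_lin scaleR_conv_of_real)
    then show "bounded_linear (\<Phi> z)" using \<Phi>_lin \<Phi>_bound by (intro bounded_linear_intro[of _ 1]) auto
  qed
  show thesis
  proof (rule exposes_range_dense[OF T \<kappa>, of U \<Phi>])
    show "norm z \<le> 1 \<and> proj B z = z" if "z \<in> U" for z using that U_ball by (auto simp: U_def)
    show "closed U" by fact
    show "w *\<^sub>C z \<in> U" if "z \<in> U" "cmod w = 1" for z w
      using that by (simp add: U_def proj_scaleC B nth_scaleC norm_scaleC)
    show "\<exists>z\<in>U. norm (S z) > norm S - h"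
      if S: "S \<in> clinops" "\<And>v. S (proj B v) = S v" and h: "h > 0" for S :: "'z \<Rightarrow>\<^sub>L 'y" and h
    proof -
      obtain v where v: "norm v \<le> 1" "norm (S v) > norm S - h"
        using norm_blinfun_nearly_attained[OF h] by blast
      obtain w where w: "norm w \<le> 1" "\<And>i. i \<in> B \<Longrightarrow> norm (nth w i) = 1" "norm (S v) \<le> norm (S w)"
        using increase_to_unit_coordinates[OF B(1) v(1) e] by blast
      have "proj B w \<in> U" using w(2) by (auto simp: U_def proj_proj B nth_proj)
      then show ?thesis using w(3) v(2) S(2) by (intro bexI[of _ "proj B w"]) auto
    qed
    show "clinear_functional (\<Phi> z)" "cmod (\<Phi> z v) \<le> norm v" for z v
      by (rule \<Phi> \<Phi>_bound)+
    show "\<Phi> z z = 1" if "z \<in> U" for z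
      using that N by (simp add: \<Phi>_def f(3) U_def N_def)
    show "\<Phi> z (proj B v) = \<Phi> z v" for z v by (simp add: \<Phi>_def nth_proj B)
    show "\<exists>d>0. \<forall>z\<in>U. \<forall>v. norm v \<le> 1 \<longrightarrow> cmod (\<Phi> z v) > 1 - d \<longrightarrow>
        (\<exists>l. cmod l = 1 \<and> norm (proj B v - l *\<^sub>C z) < h)" if h: "h > 0" for h
    proof -
      obtain g where g: "g > 0" "g \<le> 1 / 4" "\<And>f s a b. clinear_functional f \<Longrightarrow>
          (\<And>v :: 'x. cmod (f v) \<le> s * norm v) \<Longrightarrow> 0 \<le> s \<Longrightarrow> norm a \<le> 1 \<Longrightarrow> norm b \<le> 1 \<Longrightarrow>
          Re (f a) > (1 - g) * s \<Longrightarrow> Re (f b) > (1 - g) * s \<Longrightarrow> norm (a - b) < h / 2"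
        using uniformly_convex_slice[OF uc, of "h / 2"] h by auto
      have "\<exists>l. cmod l = 1 \<and> norm (proj B v - l *\<^sub>C z) < h"
        if z: "z \<in> U" and v: "norm v \<le> 1" "cmod (\<Phi> z v) > 1 - g / N" for z v
      proof -
        obtain w where w: "cmod w = 1" "w * \<Phi> z v = cmod (\<Phi> z v)"
          using exists_unit_rotation by blast
        let ?r = "\<lambda>i. Re (f (nth z i) (w *\<^sub>C nth v i))"
        have ball: "norm (w *\<^sub>C nth v i) \<le> 1" for i
          using order_trans[OF norm_nth_le v(1)] w(1) by (simp add: norm_scaleC)
        have r1: "?r i \<le> 1" for i
          by (rule order_trans[OF complex_Re_le_cmod order_trans[OF f(2) ball]])
        have "(\<Sum>i\<in>B. ?r i) = N * Re (\<Phi> z (w *\<^sub>C v))"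
          using N by (simp add: \<Phi>_def nth_scaleC)
        also have "\<dots> = N * cmod (\<Phi> z v)" using w(2) \<Phi>_lin(2)[of z w v] by simp
        also have "\<dots> > N - g" using v(2) N by (simp add: field_simps)
        finally have sum: "(\<Sum>i\<in>B. ?r i) > N - g" .
        have "norm (nth z i - w *\<^sub>C nth v i) < h / 2" if i: "i \<in> B" for i
        proof (rule g(3)[OF f(1), where s = 1])
          have "(\<Sum>j\<in>B - {i}. ?r j) \<le> (\<Sum>j\<in>B - {i}. 1)" using r1 by (intro sum_mono)
          then have "(\<Sum>j\<in>B - {i}. ?r j) \<le> N - 1"
            using B i by (simp add: N_def card_Diff_singleton of_nat_diff Suc_leI card_gt_0_iff)
          then show "Re (f (nth z i) (w *\<^sub>C nth v i)) > (1 - g) * 1"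
            using sum sum.remove[OF B(1) i, of ?r] by simp
          show "Re (f (nth z i) (nth z i)) > (1 - g) * 1" using f(3) z i g(1) by (simp add: U_def)
        qed (use f(2) ball z i in \<open>auto simp: U_def\<close>)
        then have close: "norm (nth v i - inverse w *\<^sub>C nth z i) \<le> h / 2" if "i \<in> B" for i
        proof -
          have "nth v i - inverse w *\<^sub>C nth z i = inverse w *\<^sub>C (w *\<^sub>C nth v i - nth z i)"
            using inverse_rotation(2)[OF w(1)] by (simp add: complex_vector.scale_right_diff_distrib)
          then show ?thesis
            using \<open>\<And>i. i \<in> B \<Longrightarrow> norm (nth z i - w *\<^sub>C nth v i) < h / 2\<close>[OF that]
              inverse_rotation(1)[OF w(1)]
            by (simp add: norm_scaleC norm_minus_commute)
        qed
        have z0: "nth z i = 0" if "i \<notin> B" for i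
          using z nth_proj[OF B(1), of z i] that by (simp add: U_def)
        have "norm (proj B v - inverse w *\<^sub>C z) \<le> h / 2"
          using close h z0 by (intro norm_le) (auto simp: nth_simps nth_proj B)
        then show ?thesis using inverse_rotation(1)[OF w(1)] h by (intro exI[of _ "inverse w"]) auto
      qed
      moreover have "g / N > 0" using g(1) N by simp
      ultimately show ?thesis by blast
    qed
    fix S z
    assume "S \<in> clinops" "\<And>v. S (proj B v) = S v" "norm (S - T) < \<kappa>" "z \<in> U"
      "norm (S z) = norm S" "exposes_range_at S z"
    then show thesis by (intro that[of S z]) (auto simp: U_def)
  qed
qed

end

section \<open>Complex uniform convexity implies the property\<close>

context coordinate_space
begin

text \<open>Vectors supported off \<open>E\<close> can be added to \<open>proj E z\<close> with any rotation without leaving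
  the ball. So if \<open>T\<close> nearly attains its norm at \<open>proj E z\<close>, complex uniform convexity forces
  \<open>T\<close> to be small off \<open>E\<close>.\<close>

lemma operator_small_off_support:
  fixes T :: "'z \<Rightarrow>\<^sub>L 'y::complex_banach"
  assumes d: "\<And>y0 y1 :: 'y. (\<And>w. cmod w = 1 \<Longrightarrow> norm (y0 + w *\<^sub>C y1) \<le> 1) \<Longrightarrow> norm y1 > r \<Longrightarrow>
      norm y0 < 1 - d"
    and T: "T \<in> clinops" "norm T \<le> 1" and E: "finite E"
    and z: "norm z \<le> 1" "norm (T (proj E z)) \<ge> 1 - d" and v: "proj E v = 0"
  shows "norm (T v) \<le> r * norm v"
proof -
  have unit: "norm (T u) \<le> r" if u: "norm u \<le> 1" "proj E u = 0" for u
  proof (rule ccontr)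
    assume "\<not> norm (T u) \<le> r"
    have "norm (T (proj E z) + w *\<^sub>C T u) \<le> 1" if w: "cmod w = 1" for w
    proof -
      have "norm (nth (proj E z + w *\<^sub>C u) i) \<le> 1" for i
      proof (cases "i \<in> E")
        case True
        then have "nth u i = 0" using u(2) nth_proj[OF E, of u i] by (simp add: nth_zero)
        then show ?thesis
          using True order_trans[OF norm_nth_le z(1)] by (simp add: nth_simps nth_proj E)
      next
        case False
        then show ?thesis
          using order_trans[OF norm_nth_le u(1)] w by (simp add: nth_simps nth_proj E norm_scaleC)
      qed
      then have "norm (proj E z + w *\<^sub>C u) \<le> 1" by (rule norm_le)
      then have "norm (T (proj E z + w *\<^sub>C u)) \<le> 1" using norm_blinfun_le T(2) order_trans by blast
      then show ?thesis by (simp add: blinfun.add_right clinopsD[OF T(1)])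
    qed
    with d[of "T (proj E z)" "T u"] \<open>\<not> norm (T u) \<le> r\<close> z(2) show False by simp
  qed
  show ?thesis
  proof (cases "v = 0")
    case False
    have "proj E (sgn v) = 0"
      using v linear_cmul[OF bounded_linear.linear[OF bounded_linear_proj[OF E]]]
      by (simp add: sgn_div_norm)
    then have "norm (T (sgn v)) \<le> r" using False by (intro unit) (auto simp: norm_sgn)
    then show ?thesis using False by (simp add: sgn_div_norm blinfun.scaleR_right field_simps)
  qed simp
qed

text \<open>If \<open>S\<close> exposes its range at \<open>z\<close>, it can be made to do so at any \<open>x\<close> that agrees with
  \<open>z\<close> on \<open>E\<close>: compose with a contraction that keeps the coordinates in \<open>E\<close>, ignores the others,
  and recovers the remaining part of \<open>z\<close> from one coordinate \<open>i \<in> E\<close> in which \<open>z\<close> has norm \<open>1\<close>.\<close>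

lemma exposes_range_transfer:
  fixes S :: "'z \<Rightarrow>\<^sub>L 'y::complex_banach"
  assumes S: "S \<in> clinops" "S \<noteq> 0" "exposes_range_at S z" "norm (S z) = norm S"
    and E: "finite E" "i \<in> E" and z: "norm z \<le> 1" "norm (nth z i) = 1"
    and x: "norm x \<le> 1" "proj E x = proj E z"
  obtains R Q where "R \<in> RSE" "norm R = 1" "norm x = 1" "norm (R x) = 1"
    "\<And>v. R v = (1 / norm S) *\<^sub>R S (Q v)" "\<And>v. proj E (Q v) = proj E v" "\<And>v. norm (Q v) \<le> norm v"
proof -
  obtain f where f: "clinear_functional f" "\<And>a. cmod (f a) \<le> norm a" "f (nth z i) = norm (nth z i)"
    using norming_functional by blast
  note fD = clinear_functionalD[OF f(1)]
  define Q where "Q v = proj E v + f (nth v i) *\<^sub>C (z - proj E z)" for v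
  have nth_Q: "nth (Q v) j = (if j \<in> E then nth v j else f (nth v i) *\<^sub>C nth z j)" for v j
    by (simp add: Q_def nth_simps nth_proj E)
  have Q_le: "norm (Q v) \<le> norm v" for v
  proof (rule norm_le)
    fix j
    have "norm (f (nth v i) *\<^sub>C nth z j) \<le> norm v * 1"
      unfolding norm_scaleC using order_trans[OF f(2) norm_nth_le] order_trans[OF norm_nth_le z(1)]
      by (intro mult_mono) auto
    then show "norm (nth (Q v) j) \<le> norm v" by (simp add: nth_Q norm_nth_le)
  qed
  have QE: "proj E (Q v) = proj E v" for v
    by (rule coordinates_eqI) (simp add: nth_proj E nth_Q)
  have Q_lin: "Q (u + v) = Q u + Q v" "Q (c *\<^sub>C v) = c *\<^sub>C Q v" for u v c
    by (auto intro!: coordinates_eqI simp: nth_Q nth_simps fD scaleC_add_left scaleC_scaleC)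
  have "bounded_linear Q"
    using Q_lin Q_le by (intro bounded_linear_intro[of _ 1]) (auto simp: scaleR_scaleC)
  then have "bounded_linear (\<lambda>v. (1 / norm S) *\<^sub>R S (Q v))"
    by (intro bounded_linear_const_scaleR bounded_linear_compose[OF blinfun.bounded_linear_right])
  moreover have "(1 / norm S) *\<^sub>R S (Q (c *\<^sub>C v)) = c *\<^sub>C (1 / norm S) *\<^sub>R S (Q v)" for c v
    by (simp add: Q_lin clinopsD[OF S(1)] scaleR_scaleC scaleC_scaleC mult.commute)
  ultimately obtain R where R: "R \<in> clinops" "blinfun_apply R = (\<lambda>v. (1 / norm S) *\<^sub>R S (Q v))"
    by (rule obtain_clinop)
  have Qx: "Q x = z"
  proof (rule coordinates_eqI)
    have xz: "nth x j = nth z j" if "j \<in> E" for j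
      using nth_proj[OF E(1), of x j] nth_proj[OF E(1), of z j] x(2) that by simp
    then show "nth (Q x) j = nth z j" for j
      using E f(3) z(2) by (auto simp: nth_Q)
  qed
  have Rx: "norm (R x) = 1" using S by (simp add: R(2) Qx)
  have R1: "norm (R v) \<le> 1" if "norm v \<le> 1" for v
    using norm_blinfun_le[OF order_trans[OF Q_le that], of S] S(2) by (simp add: R(2))
  then have normR: "norm R = 1"
    using Rx norm_blinfun_le[OF x(1), of R] norm_blinfun_boundI[of R 1] by auto
  have "norm x = 1" using norm_blinfun[of R x] Rx normR x(1) by simp
  have "exposes_range_at R x"
    unfolding exposes_range_at_def
  proof (intro allI impI, elim conjE)
    fix v :: "nat \<Rightarrow> 'z"
    assume v: "\<forall>n. norm (v n) \<le> 1" "(\<lambda>n. norm (R (v n))) \<longlonglongrightarrow> norm R"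
    from tendsto_mult_left[OF v(2), of "norm S"]
    have "(\<lambda>n. norm (S (Q (v n)))) \<longlonglongrightarrow> norm S" using S(2) by (simp add: R(2) normR)
    moreover have "\<forall>n. norm (Q (v n)) \<le> 1" using v(1) Q_le order_trans by blast
    ultimately obtain \<sigma> :: "nat \<Rightarrow> nat" and l where
      s: "strict_mono \<sigma>" "cmod l = 1" "(\<lambda>n. S (Q (v (\<sigma> n)))) \<longlonglongrightarrow> l *\<^sub>C S z"
      using S(3)[unfolded exposes_range_at_def, rule_format, of "\<lambda>n. Q (v n)"] by blast
    have "(\<lambda>n. R (v (\<sigma> n))) \<longlonglongrightarrow> (1 / norm S) *\<^sub>R (l *\<^sub>C S z)"
      unfolding R(2) by (intro tendsto_scaleR[OF tendsto_const s(3)])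
    also have "(1 / norm S) *\<^sub>R (l *\<^sub>C S z) = l *\<^sub>C R x"
      by (simp add: R(2) Qx scaleR_scaleC scaleC_scaleC mult.commute)
    finally show "\<exists>\<sigma> l. strict_mono \<sigma> \<and> cmod l = 1 \<and> (\<lambda>n. R (v (\<sigma> n))) \<longlonglongrightarrow> l *\<^sub>C R x"
      using s by blast
  qed
  then have "R \<in> RSE" using R(1) \<open>norm x = 1\<close> by (auto simp: RSE_iff)
  then show thesis using that[of R Q] normR \<open>norm x = 1\<close> Rx QE Q_le by (simp add: R(2))
qed

text \<open>Let \<open>F\<close> be the composition of \<open>T\<close> with a functional norming \<open>T x\<close>. On most of its mass,
  carried by a finite set \<open>B\<close>, the coordinates of \<open>x\<close> nearly norm \<open>F\<close>. A small rank-one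
  perturbation of \<open>T\<close> forces points at which nearby operators attain their norm to be nearly norming
  for \<open>F\<close>, hence close to \<open>x\<close> by uniform convexity, except on coordinates of small mass. The density
  theorem yields an operator \<open>S\<close> that exposes its range at such a point \<open>z\<close>. On the set
  \<open>E \<subseteq> B\<close> of good coordinates \<open>x\<close> and \<open>z\<close> are close; off \<open>E\<close> they are not, but there \<open>T\<close> is small
  by complex uniform convexity, so exchanging \<open>z\<close> for \<open>x\<close> off \<open>E\<close> changes the operator only
  slightly.\<close>

theorem C_uniformly_convex_imp_BPBp_RSE:
  assumes uc: "uniformly_convex TYPE('x)" and e: "(e :: 'x) \<noteq> 0"
    and cuc: "C_uniformly_convex TYPE('y::complex_banach)"
  shows "BPBp_RSE TYPE('z) TYPE('y)"
  unfolding BPBp_RSE_def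
proof (intro allI impI)
  fix \<epsilon> :: real assume "\<epsilon> > 0"
  define \<delta> where "\<delta> = min \<epsilon> 1"
  have \<delta>: "\<delta> > 0" "\<delta> \<le> 1" "\<delta> \<le> \<epsilon>" using \<open>\<epsilon> > 0\<close> by (auto simp: \<delta>_def)
  obtain g where g: "g > 0" "g \<le> 1 / 4" "\<And>f s a b. clinear_functional f \<Longrightarrow>
      (\<And>v :: 'x. cmod (f v) \<le> s * norm v) \<Longrightarrow> 0 \<le> s \<Longrightarrow> norm a \<le> 1 \<Longrightarrow> norm b \<le> 1 \<Longrightarrow>
      Re (f a) > (1 - g) * s \<Longrightarrow> Re (f b) > (1 - g) * s \<Longrightarrow> norm (a - b) < \<delta> / 3"
    using uniformly_convex_slice[OF uc, of "\<delta> / 3"] \<delta> by auto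
  define \<rho> where "\<rho> = \<delta> / 16"
  have \<rho>: "\<rho> > 0" "\<rho> \<le> 1" "\<delta> = 16 * \<rho>" using \<delta> by (auto simp: \<rho>_def)
  obtain d where d: "d > 0" "\<And>y0 y1 :: 'y. (\<And>w. cmod w = 1 \<Longrightarrow> norm (y0 + w *\<^sub>C y1) \<le> 1) \<Longrightarrow>
      norm y1 > \<rho> \<Longrightarrow> norm y0 < 1 - d"
    using cuc \<rho>(1) unfolding C_uniformly_convex_def by metis
  define m where "m = min d (1 / 2)"
  have m: "m > 0" "m \<le> d" "m \<le> 1 / 2" using d by (auto simp: m_def)
  \<comment> \<open>\<open>\<eta>2\<close> bounds both the loss of \<open>F\<close> at \<open>x\<close> from discarding coordinates and the distance of \<open>S\<close>
    from the perturbed operator; at \<open>z\<close> the loss is at most \<open>6 \<eta>2 / \<rho>\<close> before and \<open>12 \<eta>2 / (\<rho> g)\<close>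
    after discarding coordinates again, and the latter must stay below \<open>m\<close>\<close>
  define \<eta>2 where "\<eta>2 = \<rho> * g * m / 16"
  define \<eta> where "\<eta> = \<eta>2 * g / 4"
  have "g * m \<le> (1 / 4) * (1 / 2)" using g m by (intro mult_mono) auto
  then have "\<rho> * (g * m) \<le> \<rho> * (1 / 8)" using \<rho> by (intro mult_left_mono) auto
  then have \<eta>2: "\<eta>2 > 0" "\<eta>2 \<le> \<rho> / 128" using \<rho> g m by (auto simp: \<eta>2_def mult.assoc)
  have "\<eta>2 * g \<le> \<eta>2 * (1 / 4)" using \<eta>2 g by (intro mult_left_mono) auto
  then have \<eta>: "\<eta> > 0" "\<eta> \<le> \<eta>2" "4 * \<eta> / g = \<eta>2" using \<eta>2 g by (auto simp: \<eta>_def)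
  have "\<exists>S\<in>RSE. \<exists>x0\<in>sphere 0 1. norm S = 1 \<and> norm (blinfun_apply S x0) = 1 \<and> norm (S - T) < \<epsilon> \<and> norm (x - x0) < \<epsilon>"
    if T: "T \<in> clinops" "norm T = 1" and x: "norm x = 1" "norm (T x) > 1 - \<eta>"
    for T :: "'z \<Rightarrow>\<^sub>L 'y" and x
  proof -
    obtain f where f: "clinear_functional f" "\<And>a. cmod (f a) \<le> norm a" "f (T x) = norm (T x)"
      using norming_functional by blast
    note fD = clinear_functionalD[OF f(1)]
    define F where "F v = f (T v)" for v
    have T_le: "norm (T v) \<le> norm v" for v using norm_blinfun[of T v] T(2) by simp
    have F: "clinear_functional F" "\<And>v. cmod (F v) \<le> norm v"
      using bounded_linear_compose[OF fD(1) blinfun.bounded_linear_right[of T]]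
        order_trans[OF f(2) T_le]
      by (auto simp: clinear_functional_def F_def[abs_def] clinopsD[OF T(1)] fD)
    note FD = clinear_functionalD[OF F(1)]
    define t where "t = norm (T x)"
    have t: "F x = t" "t > 1 - \<eta>" using f(3) x(2) by (auto simp: F_def t_def)
    obtain J where J: "finite J" "norm (x - proj J x) \<le> \<eta>" using proj_approx[OF \<eta>(1)] by blast
    have "Re (F (proj J x)) > 1 - 2 * \<eta>"
    proof -
      have "Re (F (proj J x)) = t - Re (F (x - proj J x))" using t(1) by (simp add: FD)
      moreover have "Re (F (x - proj J x)) \<le> \<eta>"
        using complex_Re_le_cmod[of "F (x - proj J x)"] F(2)[of "x - proj J x"] J(2) by linarith
      ultimately show ?thesis using t(2) by simp
    qed
    define B where "B = {i \<in> J. Re (F (inj i (nth x i))) > (1 - g) * mass F i}"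
    have B: "finite B" using J(1) by (simp add: B_def)
    have FB: "Re (F (proj B x)) > 1 - \<eta>2"
      using nearly_norming_coordinates[OF F J(1) _ \<open>Re (F (proj J x)) > 1 - 2 * \<eta>\<close> g(1)] x(1) g(2) \<eta>(3)
      by (simp add: B_def)
    have "B \<noteq> {}"
    proof
      assume "B = {}"
      with FB have "0 > 1 - \<eta>2" by (simp add: proj_def FD(6))
      with \<eta>2 \<rho> show False by simp
    qed
    \<comment> \<open>the rank-one term rewards points at which \<open>F\<close> is large\<close>
    have "bounded_linear (\<lambda>v. T (proj B v) + \<rho> *\<^sub>R (F (proj B v) *\<^sub>C T x))"
      using bounded_linear_compose[OF bounded_linear_rank_one[OF F(1)] bounded_linear_proj[OF B]]
      by (intro bounded_linear_add bounded_linear_const_scaleR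
          bounded_linear_compose[OF blinfun.bounded_linear_right bounded_linear_proj[OF B]])
    moreover have "T (proj B (c *\<^sub>C v)) + \<rho> *\<^sub>R (F (proj B (c *\<^sub>C v)) *\<^sub>C T x) =
        c *\<^sub>C (T (proj B v) + \<rho> *\<^sub>R (F (proj B v) *\<^sub>C T x))" for c v
      by (simp add: proj_scaleC B clinopsD[OF T(1)] FD(2) scaleC_add_right scaleC_scaleC scaleR_scaleC
          mult.left_commute)
    ultimately obtain S1 where S1: "S1 \<in> clinops"
      "blinfun_apply S1 = (\<lambda>v. T (proj B v) + \<rho> *\<^sub>R (F (proj B v) *\<^sub>C T x))"
      by (rule obtain_clinop)
    have S1_T: "norm (S1 v - T (proj B v)) \<le> \<rho> * cmod (F (proj B v))" for v
    proof -
      have "norm (S1 v - T (proj B v)) = \<rho> * (cmod (F (proj B v)) * norm (T x))"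
        using \<rho>(1) by (simp add: S1(2) norm_scaleC)
      also have "\<dots> \<le> \<rho> * (cmod (F (proj B v)) * 1)"
        using \<rho>(1) T_le[of x] x(1) by (intro mult_left_mono) auto
      finally show ?thesis by simp
    qed
    have S1_lower: "norm S1 \<ge> 1 + \<rho> - 3 * \<eta>2"
    proof -
      have "f (S1 x) = F (proj B x) * (1 + \<rho> * t)"
        using f(3) by (simp add: S1(2) fD F_def t_def scaleR_conv_of_real algebra_simps)
      then have "Re (f (S1 x)) = Re (F (proj B x)) * (1 + \<rho> * t)" by simp
      moreover have "Re (f (S1 x)) \<le> norm S1"
        using complex_Re_le_cmod[of "f (S1 x)"] f(2)[of "S1 x"] norm_blinfun[of S1 x] x(1) by simp
      moreover have "Re (F (proj B x)) * (1 + \<rho> * t) \<ge> (1 - \<eta>2) * (1 + \<rho> * (1 - \<eta>))"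
        using FB t(2) \<rho> \<eta> \<eta>2 by (intro mult_mono add_left_mono mult_left_mono) auto
      moreover have "(1 - \<eta>2) * (1 + \<rho> * (1 - \<eta>)) = 1 + \<rho> - \<rho> * \<eta> - \<eta>2 - \<rho> * \<eta>2 + \<eta>2 * \<rho> * \<eta>"
        by (simp add: algebra_simps)
      moreover have "\<rho> * \<eta> \<le> \<eta>2" "\<rho> * \<eta>2 \<le> \<eta>2" "\<eta>2 * \<rho> * \<eta> \<ge> 0"
        using mult_mono[OF \<rho>(2) \<eta>(2)] mult_mono[OF \<rho>(2) order_refl[of \<eta>2]] \<rho> \<eta>(1) \<eta>2 by auto
      ultimately show ?thesis by linarith
    qed
    have "S1 (proj B v) = S1 v" for v by (simp add: S1(2) proj_proj B)
    moreover have "S1 \<noteq> 0" using S1_lower \<rho> \<eta>2 by auto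
    ultimately obtain S u where S: "S \<in> clinops" "\<And>v. S (proj B v) = S v" "norm (S - S1) < \<eta>2"
      and u: "proj B u = u" "\<And>i. i \<in> B \<Longrightarrow> norm (nth u i) = 1" "norm (S u) = norm S"
        "exposes_range_at S u"
      using exposes_range_dense_on_coordinates[OF uc B \<open>B \<noteq> {}\<close> e S1(1) _ _ \<eta>2(1)] by blast
    obtain w where w: "cmod w = 1" "w * F u = cmod (F u)" using exists_unit_rotation by blast
    define z where "z = w *\<^sub>C u"
    have z: "proj B z = z" "\<And>i. i \<in> B \<Longrightarrow> norm (nth z i) = 1" "norm (S z) = norm S"
      "exposes_range_at S z" "F z = cmod (F u)" "cmod (F z) = cmod (F u)"
      using u w exposes_range_at_rotate[OF S(1) u(4) w(1)]
      by (auto simp: z_def proj_scaleC B nth_scaleC norm_scaleC clinopsD[OF S(1)] FD norm_mult)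
    have z1: "norm z \<le> 1"
    proof (rule norm_le)
      show "norm (nth z i) \<le> 1" for i
        using z(2)[of i] nth_proj[OF B, of z i] z(1) by (cases "i \<in> B") auto
    qed
    have S_S1: "norm (S v - S1 v) \<le> \<eta>2" if "norm v \<le> 1" for v
      using norm_blinfun_le[OF that, of "S - S1"] S(3) by (simp add: blinfun.diff_left)
    have S_lower: "norm S \<ge> 1 + \<rho> - 4 * \<eta>2"
      using S1_lower S(3) norm_triangle_ineq2[of S1 S] by (simp add: norm_minus_commute)
    have S_upper: "norm (S v) \<le> 1 + \<rho> * cmod (F (proj B v)) + \<eta>2" if v: "norm v \<le> 1" for v
    proof -
      have "norm (S v) \<le> norm (T (proj B v)) + norm (S1 v - T (proj B v)) + norm (S v - S1 v)"
        using norm_triangle_ineq[of "T (proj B v)" "(S1 v - T (proj B v)) + (S v - S1 v)"]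
          norm_triangle_ineq[of "S1 v - T (proj B v)" "S v - S1 v"] by simp
      moreover have "norm (T (proj B v)) \<le> 1"
        using T_le[of "proj B v"] norm_proj_le[OF B, of v] v by linarith
      ultimately show ?thesis using S1_T[of v] S_S1[OF v] by linarith
    qed
    have FP: "cmod (F (proj B v)) \<le> 1" if "norm v \<le> 1" for v
      using F(2)[of "proj B v"] norm_proj_le[OF B, of v] that by linarith
    have S_norm_le: "norm S \<le> 1 + \<rho> + \<eta>2"
    proof (rule norm_blinfun_boundI)
      show "norm (S v) \<le> 1 + \<rho> + \<eta>2" if "norm v \<le> 1" for v
        using S_upper[OF that] mult_left_mono[OF FP[OF that] less_imp_le[OF \<rho>(1)]] by linarith
    qed
    have FBz: "Re (F (proj B z)) > 1 - 6 * \<eta>2 / \<rho>"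
    proof -
      have "\<rho> * cmod (F z) \<ge> \<rho> - 5 * \<eta>2"
        using S_upper[OF z1] S_lower z(1,3) by simp
      then have "\<rho> * cmod (F z) > \<rho> * (1 - 6 * \<eta>2 / \<rho>)" using \<rho>(1) \<eta>2(1) by (simp add: right_diff_distrib)
      then show ?thesis using \<rho>(1) z(1,5,6) by simp
    qed
    have "2 * (6 * \<eta>2 / \<rho>) / g = 3 / 4 * m" using \<rho> g by (simp add: \<eta>2_def)
    moreover define E where "E = {i \<in> B. Re (F (inj i (nth z i))) > (1 - g) * mass F i}"
    ultimately have FE: "Re (F (proj E z)) > 1 - 3 / 4 * m"
      using nearly_norming_coordinates[OF F B z1 FBz g(1)] g(2) unfolding E_def by linarith
    have E: "finite E" "E \<subseteq> B" using B by (auto simp: E_def)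
    have "E \<noteq> {}"
    proof
      assume "E = {}"
      with FE m show False by (simp add: proj_def FD(6))
    qed
    then obtain i where i: "i \<in> E" by blast
    have "norm (T (proj E z)) \<ge> 1 - d"
      using FE m complex_Re_le_cmod[of "F (proj E z)"] f(2)[of "T (proj E z)"] unfolding F_def by linarith
    then have small: "norm (T v) \<le> \<rho> * norm v" if "proj E v = 0" for v
      using T that by (intro operator_small_off_support[where r = \<rho> and d = d, OF d(2) _ _ E(1) z1]) auto
    define x0 where "x0 = proj E z + (x - proj E x)"
    have nth_x0: "nth x0 j = (if j \<in> E then nth z j else nth x j)" for j
      by (simp add: x0_def nth_simps nth_proj E)
    have x0: "norm x0 \<le> 1" "proj E x0 = proj E z"
      using order_trans[OF norm_nth_le z1] order_trans[OF norm_nth_le, of x 1] x(1)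
      by (auto intro!: norm_le coordinates_eqI simp: nth_x0 nth_proj E)
    have "norm (x - x0) \<le> \<delta> / 3"
    proof (rule norm_le)
      fix j
      show "norm (nth (x - x0) j) \<le> \<delta> / 3"
      proof (cases "j \<in> E")
        case True
        have "norm (nth x j - nth z j) < \<delta> / 3"
        proof (rule g(3)[where f = "\<lambda>a. F (inj j a)" and s = "mass F j"])
          show "norm (nth x j) \<le> 1" using norm_nth_le[of x j] x(1) by simp
          show "norm (nth z j) \<le> 1" by (rule order_trans[OF norm_nth_le z1])
        qed (use True in \<open>auto simp: E_def B_def clinear_functional_inj F mass_bound mass_nonneg\<close>)
        with True show ?thesis by (simp add: nth_diff nth_x0)
      qed (use \<delta> in \<open>simp add: nth_diff nth_x0\<close>)
    qed
    moreover have "S \<noteq> 0" using S_lower \<rho> \<eta>2 by auto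
    ultimately obtain R Q where R: "R \<in> RSE" "norm R = 1" "norm x0 = 1" "norm (R x0) = 1"
      "\<And>v. R v = (1 / norm S) *\<^sub>R S (Q v)" and Q: "\<And>v. proj E (Q v) = proj E v" "\<And>v. norm (Q v) \<le> norm v"
      using exposes_range_transfer[OF S(1) _ z(4,3) E(1) i z1 _ x0] z(2) i E(2) by blast
    have "norm (R - T) \<le> 9 * \<rho>"
    proof (rule norm_blinfun_boundI)
      fix v :: 'z assume v: "norm v \<le> 1"
      have Qv: "norm (Q v) \<le> 1" using Q(2) v order_trans by blast
      have "S (Q v) = norm S *\<^sub>R R v" using \<open>S \<noteq> 0\<close> by (simp add: R(5))
      then have "R v - S (Q v) = (1 - norm S) *\<^sub>R R v" by (simp add: scaleR_left_diff_distrib)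
      then have "norm (R v - S (Q v)) = \<bar>1 - norm S\<bar> * norm (R v)" by simp
      also have "\<dots> \<le> (\<rho> + \<eta>2) * 1"
        using norm_blinfun_le[OF v, of R] R(2) S_lower S_norm_le \<eta>2 \<rho> by (intro mult_mono) auto
      finally have 1: "norm (R v - S (Q v)) \<le> \<rho> + \<eta>2" by simp
      have 2: "norm (S1 (Q v) - T (proj B (Q v))) \<le> \<rho>"
        using S1_T[of "Q v"] mult_left_mono[OF FP[OF Qv] less_imp_le[OF \<rho>(1)]] by linarith
      have "proj E (proj B (Q v) - v) = 0"
        using E B Q(1) by (simp add: proj_diff proj_proj Int_absorb2)
      then have "norm (T (proj B (Q v) - v)) \<le> \<rho> * norm (proj B (Q v) - v)" by (rule small)
      also have "\<dots> \<le> \<rho> * 2"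
        using norm_triangle_ineq4[of "proj B (Q v)" v] norm_proj_le[OF B, of "Q v"] Qv v \<rho>(1)
        by (intro mult_left_mono) auto
      finally have 3: "norm (T (proj B (Q v) - v)) \<le> 2 * \<rho>" by simp
      have RT: "(R - T) v = (R v - S (Q v)) + (S (Q v) - S1 (Q v)) + (S1 (Q v) - T (proj B (Q v)))
          + T (proj B (Q v) - v)"
        by (simp add: blinfun.diff_left blinfun.diff_right)
      have "norm ((R - T) v) \<le> norm (R v - S (Q v)) + norm (S (Q v) - S1 (Q v))
          + norm (S1 (Q v) - T (proj B (Q v))) + norm (T (proj B (Q v) - v))"
        unfolding RT by (intro order_trans[OF norm_triangle_ineq] add_mono order_refl)
      then show "norm ((R - T) v) \<le> 9 * \<rho>" using 1 2 3 S_S1[OF Qv] \<eta>2 \<rho>(1) by linarith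
    qed
    then have "norm (R - T) < \<epsilon>" using \<rho>(1,3) \<delta> by simp
    moreover have "norm (x - x0) < \<epsilon>" using \<open>norm (x - x0) \<le> \<delta> / 3\<close> \<delta> by simp
    ultimately show ?thesis using R by (intro bexI[of _ R] bexI[of _ x0]) auto
  qed
  moreover have "\<eta> < \<epsilon>" using \<eta> \<eta>2 \<rho> \<delta> by simp
  ultimately show "\<exists>\<eta>>0. \<eta> < \<epsilon> \<and> (\<forall>T\<in>clinops :: ('z \<Rightarrow>\<^sub>L 'y) set. \<forall>x\<in>sphere 0 1. norm T = 1 \<and> 1 - \<eta> < norm (blinfun_apply T x) \<longrightarrow>
      (\<exists>S\<in>RSE. \<exists>x0\<in>sphere 0 1. norm S = 1 \<and> norm (blinfun_apply S x0) = 1 \<and> norm (S - T) < \<epsilon> \<and> norm (x - x0) < \<epsilon>))"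
    using \<eta>(1) by (intro exI[of _ \<eta>]) auto
qed

end

section \<open>The property implies complex uniform convexity\<close>

text \<open>If the midpoint of a segment in the ball norms \<open>S\<close>, so do both end points. Applied
  to the constant sequences at these points, exposedness puts their images on one circle, where no
  point is the midpoint of two distinct points.\<close>

lemma exposes_range_at_imp_zero:
  assumes S: "S \<in> clinops" "exposes_range_at S z" "norm S = 1"
    and a: "norm (S a) = 1" "norm (a + v) \<le> 1" "norm (a - v) \<le> 1"
  shows "S v = 0"
proof -
  have circle: "\<exists>l. cmod l = 1 \<and> S b = l *\<^sub>C S z" if b: "norm b \<le> 1" "norm (S b) = 1" for b
  proof -
    have "(\<forall>n::nat. norm b \<le> 1) \<and> (\<lambda>n::nat. norm (S b)) \<longlonglongrightarrow> norm S" using b S(3) by simp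
    then obtain l where "cmod l = 1" "(\<lambda>n::nat. S b) \<longlonglongrightarrow> l *\<^sub>C S z"
      using S(2)[unfolded exposes_range_at_def, rule_format, of "\<lambda>_. b"] by blast
    then show ?thesis using LIMSEQ_const_iff by blast
  qed
  have two: "S (a + v) + S (a - v) = 2 *\<^sub>R S a"
    by (simp add: blinfun.add_right blinfun.diff_right scaleR_2)
  have le: "norm (S (a + v)) \<le> 1" "norm (S (a - v)) \<le> 1"
    using norm_blinfun_le[OF a(2), of S] norm_blinfun_le[OF a(3), of S] S(3) by auto
  have "2 \<le> norm (S (a + v)) + norm (S (a - v))"
    using norm_triangle_ineq[of "S (a + v)" "S (a - v)"] a(1) unfolding two by simp
  with le have "norm (S (a + v)) = 1" "norm (S (a - v)) = 1" by auto
  with circle a obtain l m where lm: "cmod l = 1" "S (a + v) = l *\<^sub>C S z" "cmod m = 1" "S (a - v) = m *\<^sub>C S z"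
    by metis
  have z: "norm (S z) = 1" using lm(1,2) \<open>norm (S (a + v)) = 1\<close> by (simp add: norm_scaleC)
  have "(l + m) *\<^sub>C S z = 2 *\<^sub>R S a" using two lm by (simp add: scaleC_add_left)
  then have "cmod (l + m) * norm (S z) = 2" using a(1) by (metis norm_scaleC norm_scaleR abs_numeral mult_1_right real_norm_def)
  then have "cmod (l + m) = 2" using z by simp
  moreover have "(cmod (l + m))\<^sup>2 + (cmod (l - m))\<^sup>2 = 2 * (cmod l)\<^sup>2 + 2 * (cmod m)\<^sup>2"
    by (simp only: cmod_power2) (simp add: power2_eq_square algebra_simps)
  ultimately have "l = m" using lm by simp
  then have "S (a + v) = S (a - v)" using lm by simp
  then have "2 *\<^sub>R S v = 0" by (simp add: blinfun.add_right blinfun.diff_right scaleR_2 algebra_simps)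
  then show ?thesis by simp
qed

text \<open>A point of the bidisc is a midpoint of midpoints of points of the torus.\<close>

lemma bidisc_bound:
  fixes y0 y1 :: "'y::complex_normed_vector"
  assumes y: "\<And>w. cmod w = 1 \<Longrightarrow> norm (y0 + w *\<^sub>C y1) \<le> 1" and ab: "cmod a \<le> 1" "cmod b \<le> 1"
  shows "norm (a *\<^sub>C y0 + b *\<^sub>C y1) \<le> 1"
proof -
  have mid: "norm u \<le> 1" if "v + w = 2 *\<^sub>R u" "norm v \<le> 1" "norm w \<le> 1" for u v w :: 'y
  proof -
    have "norm (2 *\<^sub>R u) \<le> norm v + norm w" unfolding that(1)[symmetric] by (rule norm_triangle_ineq)
    with that show ?thesis by simp
  qed
  have two: "2 *\<^sub>R u = (2::complex) *\<^sub>C u" for u :: 'y by (simp add: scaleR_scaleC)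
  have torus: "norm (p *\<^sub>C y0 + q *\<^sub>C y1) \<le> 1" if "cmod p = 1" "cmod q = 1" for p q
  proof -
    have "p *\<^sub>C y0 + q *\<^sub>C y1 = p *\<^sub>C (y0 + (inverse p * q) *\<^sub>C y1)"
      using inverse_rotation(3)[OF that(1)]
      by (simp add: scaleC_add_right scaleC_scaleC mult.assoc[symmetric])
    then show ?thesis using y[of "inverse p * q"] that by (simp add: norm_scaleC norm_mult norm_inverse)
  qed
  obtain p p' where p: "cmod p = 1" "cmod p' = 1" "p + p' = 2 * a"
    using complex_midpoint_of_units[OF ab(1)] .
  obtain q q' where q: "cmod q = 1" "cmod q' = 1" "q + q' = 2 * b"
    using complex_midpoint_of_units[OF ab(2)] .
  have half: "norm (r *\<^sub>C y0 + b *\<^sub>C y1) \<le> 1" if "cmod r = 1" for r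
  proof (rule mid[OF _ torus[OF that q(1)] torus[OF that q(2)]])
    have "(r *\<^sub>C y0 + q *\<^sub>C y1) + (r *\<^sub>C y0 + q' *\<^sub>C y1) = (2 * r) *\<^sub>C y0 + (q + q') *\<^sub>C y1"
      by (simp only: mult_2 scaleC_add_left add_ac)
    also have "\<dots> = 2 *\<^sub>R (r *\<^sub>C y0 + b *\<^sub>C y1)"
      unfolding q(3) two by (simp add: scaleC_add_right scaleC_scaleC)
    finally show "(r *\<^sub>C y0 + q *\<^sub>C y1) + (r *\<^sub>C y0 + q' *\<^sub>C y1) = 2 *\<^sub>R (r *\<^sub>C y0 + b *\<^sub>C y1)" .
  qed
  show ?thesis
  proof (rule mid[OF _ half[OF p(1)] half[OF p(2)]])
    have "(p *\<^sub>C y0 + b *\<^sub>C y1) + (p' *\<^sub>C y0 + b *\<^sub>C y1) = (p + p') *\<^sub>C y0 + (2 * b) *\<^sub>C y1"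
      by (simp only: mult_2 scaleC_add_left add_ac)
    also have "\<dots> = 2 *\<^sub>R (a *\<^sub>C y0 + b *\<^sub>C y1)"
      unfolding p(3) two by (simp add: scaleC_add_right scaleC_scaleC)
    finally show "(p *\<^sub>C y0 + b *\<^sub>C y1) + (p' *\<^sub>C y0 + b *\<^sub>C y1) = 2 *\<^sub>R (a *\<^sub>C y0 + b *\<^sub>C y1)" .
  qed
qed

context coordinate_space
begin

text \<open>A pair \<open>y0\<close>, \<open>y1\<close> violating complex uniform convexity gives an operator acting by \<open>y0\<close> on
  one coordinate and by \<open>y1\<close> on another. It nearly attains its norm at a vector supported on the
  first coordinate, so a nearby range strongly exposing operator attains its norm at a vector whose
  second coordinate has room for perturbations. It vanishes on these, whereas \<open>y1\<close> is not small.\<close>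

theorem BPBp_RSE_imp_C_uniformly_convex:
  assumes bpb: "BPBp_RSE TYPE('z) TYPE('y::complex_banach)"
    and e: "(e :: 'x) \<noteq> 0" and ij: "(i :: 'i) \<noteq> j"
  shows "C_uniformly_convex TYPE('y)"
  unfolding C_uniformly_convex_def
proof (intro allI impI)
  fix \<epsilon> :: real assume "\<epsilon> > 0"
  define \<delta> where "\<delta> = min \<epsilon> (1 / 2)"
  have \<delta>: "\<delta> > 0" "\<delta> \<le> 1 / 2" "\<delta> \<le> \<epsilon>" using \<open>\<epsilon> > 0\<close> by (auto simp: \<delta>_def)
  obtain \<eta> where \<eta>: "0 < \<eta>" "\<eta> < \<delta>" and approx: "\<And>(T :: 'z \<Rightarrow>\<^sub>L 'y) x. T \<in> clinops \<Longrightarrow> norm x = 1 \<Longrightarrow>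
      norm T = 1 \<Longrightarrow> norm (T x) > 1 - \<eta> \<Longrightarrow>
      \<exists>S\<in>RSE. \<exists>x0. norm S = 1 \<and> norm (blinfun_apply S x0) = 1 \<and> norm (S - T) < \<delta> \<and> norm (x0 :: 'z) = 1 \<and>
        norm (x - x0) < \<delta>"
    using bpb \<delta>(1) unfolding BPBp_RSE_def by (metis mem_sphere_0)
  obtain u :: 'x where u: "norm u = 1" using e that[of "sgn e"] by (simp add: norm_sgn)
  obtain f where f: "clinear_functional f" "\<And>a :: 'x. cmod (f a) \<le> norm a" "f u = 1"
    using norming_functional[of u] u by auto
  note fD = clinear_functionalD[OF f(1)]
  have "norm y0 < 1 - \<eta> / 2"
    if y: "\<And>w. cmod w = 1 \<Longrightarrow> norm (y0 + w *\<^sub>C y1) \<le> 1" "norm y1 > \<epsilon>" for y0 y1 :: 'y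
  proof (rule ccontr)
    assume "\<not> norm y0 < 1 - \<eta> / 2"
    then have y0: "norm y0 > 1 - \<eta>" using \<eta>(1) by simp
    have "bounded_linear (\<lambda>v. f (nth v i) *\<^sub>C y0 + f (nth v j) *\<^sub>C y1)"
      using bounded_linear_compose[OF bounded_linear_rank_one[OF f(1)] bounded_linear_nth]
      by (intro bounded_linear_add)
    moreover have "f (nth (c *\<^sub>C v) i) *\<^sub>C y0 + f (nth (c *\<^sub>C v) j) *\<^sub>C y1 =
        c *\<^sub>C (f (nth v i) *\<^sub>C y0 + f (nth v j) *\<^sub>C y1)" for c v
      by (simp add: nth_scaleC fD scaleC_add_right scaleC_scaleC)
    ultimately obtain T0 where T0: "T0 \<in> clinops"
      "blinfun_apply T0 = (\<lambda>v. f (nth v i) *\<^sub>C y0 + f (nth v j) *\<^sub>C y1)"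
      by (rule obtain_clinop)
    have T0_i: "T0 (inj i u) = y0" and T0_j: "T0 (inj j a) = f a *\<^sub>C y1" for a
      using ij f(3) by (auto simp: T0(2) nth_inj fD)
    have inj_u: "norm (inj i u) = 1"
    proof (rule antisym)
      show "norm (inj i u) \<le> 1" by (rule norm_le) (simp add: nth_inj u)
      show "1 \<le> norm (inj i u)" using norm_nth_le[of "inj i u" i] u by (simp add: nth_inj)
    qed
    have T0_le: "norm T0 \<le> 1"
    proof (rule norm_blinfun_boundI)
      fix v :: 'z assume v: "norm v \<le> 1"
      have "cmod (f (nth v k)) \<le> 1" for k using f(2) norm_nth_le v by (meson order_trans)
      then show "norm (T0 v) \<le> 1" unfolding T0(2) by (intro bidisc_bound y(1))
    qed
    have "norm y0 \<le> norm T0" using norm_blinfun_le[of "inj i u" T0] inj_u T0_i by simp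
    then have pos: "norm T0 > 0" using y0 \<eta>(2) \<delta>(2) by linarith
    define T where "T = (1 / norm T0) *\<^sub>R T0"
    have T_ge: "norm (T v) \<ge> norm (T0 v)" for v
      using mult_right_mono[of 1 "1 / norm T0" "norm (T0 v)"] T0_le pos
      by (simp add: T_def blinfun.scaleR_left field_simps)
    have "T \<in> clinops"
      using T0(1) by (simp add: T_def clinops_def blinfun.scaleR_left scaleR_scaleC scaleC_scaleC mult.commute)
    moreover have "norm T = 1" using pos by (simp add: T_def)
    moreover have "norm (T (inj i u)) > 1 - \<eta>" using T_ge[of "inj i u"] T0_i y0 by simp
    ultimately obtain S x0 where S: "S \<in> RSE" "norm S = 1" "norm (S x0) = 1" "norm (S - T) < \<delta>"
      and x0: "norm x0 = 1" "norm (inj i u - x0) < \<delta>"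
      using approx inj_u by blast
    define v where "v = inj j ((1 - \<delta>) *\<^sub>R u)"
    have x0j: "norm (nth x0 j) < \<delta>"
      using norm_nth_le[of "inj i u - x0" j] x0(2) ij by (simp add: nth_simps)
    have room: "norm (nth x0 k + nth (c *\<^sub>R v) k) \<le> 1" if "\<bar>c\<bar> = 1" for c k
    proof (cases "k = j")
      case True
      then have "norm (nth (c *\<^sub>R v) k) = 1 - \<delta>"
        using that \<delta>(2) u by (simp add: v_def nth_simps abs_mult)
      then show ?thesis using x0j True norm_triangle_ineq[of "nth x0 k" "nth (c *\<^sub>R v) k"] by simp
    next
      case False
      then show ?thesis using norm_nth_le[of x0 k] x0(1) by (simp add: v_def nth_simps)
    qed
    have "norm (x0 + v) \<le> 1" using room[of 1] by (intro norm_le) (simp add: nth_simps)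
    moreover have "norm (x0 - v) \<le> 1" using room[of "-1"] by (intro norm_le) (simp add: nth_simps)
    ultimately have "S v = 0"
      using S exposes_range_at_imp_zero[of S _ x0 v] by (auto simp: RSE_iff)
    then have "norm (T v) = norm ((S - T) v)" by (simp add: blinfun.diff_left)
    also have "\<dots> \<le> norm (S - T) * norm v" by (rule norm_blinfun)
    also have "\<dots> \<le> \<delta> * (1 - \<delta>)"
    proof (rule mult_mono)
      show "norm v \<le> 1 - \<delta>" using u \<delta>(2) by (intro norm_le) (simp add: v_def nth_inj)
    qed (use S(4) \<delta> in auto)
    finally have "norm (T v) \<le> \<delta> * (1 - \<delta>)" .
    moreover have "norm (T0 v) = (1 - \<delta>) * norm y1"
      using T0_j[of "(1 - \<delta>) *\<^sub>R u"] f(3) fD(7) \<delta>(2) by (simp add: v_def norm_scaleC)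
    ultimately have "(1 - \<delta>) * norm y1 \<le> (1 - \<delta>) * \<delta>" using T_ge[of v] by (simp add: mult.commute)
    then show False using y(2) \<delta> by simp
  qed
  then show "\<exists>\<delta>>0. \<forall>y0 y1 :: 'y. (\<forall>w. cmod w = 1 \<longrightarrow> norm (y0 + w *\<^sub>C y1) \<le> 1) \<and> \<epsilon> < norm y1 \<longrightarrow>
      norm y0 < 1 - \<delta>"
    using \<eta>(1) by (intro exI[of _ "\<eta> / 2"]) auto
qed

theorem BPBp_RSE_iff_C_uniformly_convex:
  assumes "uniformly_convex TYPE('x)" "(e :: 'x) \<noteq> 0" "(i :: 'i) \<noteq> j"
  shows "BPBp_RSE TYPE('z) TYPE('y::complex_banach) \<longleftrightarrow> C_uniformly_convex TYPE('y)"
  using C_uniformly_convex_imp_BPBp_RSE[OF assms(1,2)] BPBp_RSE_imp_C_uniformly_convex[OF _ assms(2,3)]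
  by blast

end

section \<open>The spaces \<open>c\<^sub>0(X)\<close> and \<open>\<ell>\<^sub>\<infinity>\<^sup>m(X)\<close>\<close>

lemma c0_nth_Abs_single: "c0_nth (Abs_c0 (\<lambda>j. if j = i then a else 0)) j = (if j = i then a else 0)"
proof -
  have "(\<lambda>j. if j = i then a else 0) \<longlonglongrightarrow> 0"
    by (intro tendsto_eventually eventually_sequentiallyI[of "Suc i"]) auto
  then show ?thesis by (simp add: Abs_c0_inverse)
qed

lemma coordinate_space_c0:
  "coordinate_space (c0_nth :: 'x::complex_banach c0 \<Rightarrow> nat \<Rightarrow> 'x)
     (\<lambda>i a. Abs_c0 (\<lambda>j. if j = i then a else 0))"
proof
  fix v :: "'x c0" and e :: real assume "e > 0"
  then obtain N where "\<And>i. i \<ge> N \<Longrightarrow> norm (c0_nth v i) < e"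
    using LIMSEQ_D[OF c0_nth_tendsto, of e v] by auto
  then have "{i. e \<le> norm (c0_nth v i)} \<subseteq> {..<N}" by (auto simp: not_le[symmetric])
  then show "finite {i. e \<le> norm (c0_nth v i)}" by (rule finite_subset) simp
qed (simp_all add: c0_nth_simps c0_nth_Abs_single norm_c0_nth_le norm_c0_le)

lemma coordinate_space_linf:
  "coordinate_space (linf_nth :: ('x::complex_banach, 'm::finite) linf \<Rightarrow> 'm \<Rightarrow> 'x)
     (\<lambda>i a. Abs_linf (\<lambda>j. if j = i then a else 0))"
  by standard (simp_all add: linf_nth_simps Abs_linf_inverse norm_linf_nth_le norm_linf_le)

theorem theorem3p9:
  assumes "dim_at_least_two TYPE('x::complex_banach)"
    and "dim_at_least_two TYPE('y::complex_banach)"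
    and "uniformly_convex TYPE('x)"
    and "CARD('m::finite) \<ge> 2"
  shows "(BPBp_RSE TYPE('x c0) TYPE('y) \<longleftrightarrow> BPBp_RSE TYPE(('x, 'm) linf) TYPE('y)) \<and>
         (BPBp_RSE TYPE(('x, 'm) linf) TYPE('y) \<longleftrightarrow> C_uniformly_convex TYPE('y))"
proof -
  obtain B :: "'x set" where B: "complex_vector.independent B" "card B = 2"
    using assms(1) by (auto simp: dim_at_least_two_def)
  then have "B \<noteq> {}" by auto
  then obtain e where "e \<in> B" by blast
  then have e: "e \<noteq> 0" using B(1) complex_vector.dependent_zero by blast
  have "\<exists>i j :: 'm. i \<noteq> j"
    using assms(4) card_le_Suc0_iff_eq[of "UNIV :: 'm set"] by auto
  then obtain i j :: 'm where "i \<noteq> j" by blast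
  from coordinate_space.BPBp_RSE_iff_C_uniformly_convex[OF coordinate_space_linf assms(3) e this]
    coordinate_space.BPBp_RSE_iff_C_uniformly_convex[OF coordinate_space_c0 assms(3) e, of 0 1]
  show ?thesis by auto
qed

end
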